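(* (1) A Cohen–Macaulay $\Lambda$-module is indecomposable if and only if it is isomorphic to $(i,j)$ for some $1\le i<j\le n$. (2) Every Cohen–Macaulay $\Lambda$-module is isomorphic to $\bigoplus_{1\le i<j\le n}(i,j)^{l_{i,j}}$ for some non-negative integers $l_{i,j}$, and the $l_{i,j}$ are uniquely determined.
   Context: $K$ a field, $R=K[x]$, $n\ge3$. $\Lambda\subset M_n(K(x))$ is the $R$-order whose $(i,j)$ entry ranges over $x^{c_{ij}}R$, $c_{ij}=0$ for $i\le j$ except $c_{1n}=-1$, $c_{ij}=1$ if $i=j+1$, $c_{ij}=2$ if $i\ge j+2$. A Cohen–Macaulay $\Lambda$-module is a finitely generated left $\Lambda$-module which is free as an $R$-module. For $1\le i<j\le n$, $(i,j)$ is the $\Lambda$-module of column vectors $[R\cdots R\,(x)\cdots(x)\,(x^2)\cdots(x^2)]^t\subset K(x)^n$ with $i$ entries in $R$, $j-i$ entries in $xR$ and $n-j$ entries in $x^2R$, $\Lambda$ acting by matrix multiplication. *)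

theory Defs
  imports "HOL-Computational_Algebra.Polynomial" "HOL-Computational_Algebra.Polynomial_Factorial"
    "Jordan_Normal_Form.Matrix"
begin

text \<open>R = K[x] is ''k poly, K(x) is its fraction field ''k poly fract.
  Matrices/vectors over K(x) use Jordan_Normal_Form (0-based indices);
  the paper's 1-based indices are translated by +1.\<close>

type_synonym 'k Kx = "'k poly fract"

definition xvar :: "'k::field Kx" where
  "xvar = to_fract [:0, 1:]"

definition in_xR :: "int \<Rightarrow> 'k::field Kx \<Rightarrow> bool" where
  "in_xR c a \<longleftrightarrow> (\<exists>p. a = xvar powi c * to_fract p)"

definition cexp :: "nat \<Rightarrow> nat \<Rightarrow> nat \<Rightarrow> int" where
  "cexp n i j = (if i \<le> j then (if i = 1 \<and> j = n then -1 else 0)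
                 else if i = j + 1 then 1 else 2)"

definition Lambda :: "nat \<Rightarrow> 'k::field Kx mat set" where
  "Lambda n = {A \<in> carrier_mat n n.
      \<forall>i<n. \<forall>j<n. in_xR (cexp n (i+1) (j+1)) (A $$ (i, j))}"

record ('a, 'm) lmod =
  lcarrier :: "'m set"
  ladd :: "'m \<Rightarrow> 'm \<Rightarrow> 'm"
  lzero :: "'m"
  lact :: "'a \<Rightarrow> 'm \<Rightarrow> 'm"

definition is_Lambda_module :: "nat \<Rightarrow> ('k::field Kx mat, 'm) lmod \<Rightarrow> bool" where
  "is_Lambda_module n M \<longleftrightarrow>
    lzero M \<in> lcarrier M \<and>
    (\<forall>a\<in>lcarrier M. \<forall>b\<in>lcarrier M. ladd M a b \<in> lcarrier M) \<and>
    (\<forall>A\<in>Lambda n. \<forall>a\<in>lcarrier M. lact M A a \<in> lcarrier M) \<and>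
    (\<forall>a\<in>lcarrier M. \<forall>b\<in>lcarrier M. \<forall>c\<in>lcarrier M.
        ladd M (ladd M a b) c = ladd M a (ladd M b c)) \<and>
    (\<forall>a\<in>lcarrier M. \<forall>b\<in>lcarrier M. ladd M a b = ladd M b a) \<and>
    (\<forall>a\<in>lcarrier M. ladd M (lzero M) a = a) \<and>
    (\<forall>a\<in>lcarrier M. \<exists>b\<in>lcarrier M. ladd M a b = lzero M) \<and>
    (\<forall>A\<in>Lambda n. \<forall>a\<in>lcarrier M. \<forall>b\<in>lcarrier M.
        lact M A (ladd M a b) = ladd M (lact M A a) (lact M A b)) \<and>
    (\<forall>A\<in>Lambda n. \<forall>B\<in>Lambda n. \<forall>a\<in>lcarrier M.
        lact M (A + B) a = ladd M (lact M A a) (lact M B a)) \<and>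
    (\<forall>A\<in>Lambda n. \<forall>B\<in>Lambda n. \<forall>a\<in>lcarrier M.
        lact M (A * B) a = lact M A (lact M B a)) \<and>
    (\<forall>a\<in>lcarrier M. lact M (1\<^sub>m n) a = a)"

fun lcomb :: "('a, 'm) lmod \<Rightarrow> ('s \<Rightarrow> 'm \<Rightarrow> 'm) \<Rightarrow> ('s \<times> 'm) list \<Rightarrow> 'm" where
  "lcomb M f [] = lzero M"
| "lcomb M f ((s, g) # xs) = ladd M (f s g) (lcomb M f xs)"

definition finitely_generated :: "nat \<Rightarrow> ('k::field Kx mat, 'm) lmod \<Rightarrow> bool" where
  "finitely_generated n M \<longleftrightarrow>
    (\<exists>gs. set gs \<subseteq> lcarrier M \<and>
      (\<forall>m\<in>lcarrier M. \<exists>As. length As = length gs \<and> set As \<subseteq> Lambda n \<and>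
          m = lcomb M (lact M) (zip As gs)))"

text \<open>the action of R = K[x] through the scalar matrices r I (which lie in Lambda)\<close>
definition ract :: "nat \<Rightarrow> ('k::field Kx mat, 'm) lmod \<Rightarrow> 'k poly \<Rightarrow> 'm \<Rightarrow> 'm" where
  "ract n M r m = lact M (to_fract r \<cdot>\<^sub>m 1\<^sub>m n) m"

definition R_free :: "nat \<Rightarrow> ('k::field Kx mat, 'm) lmod \<Rightarrow> bool" where
  "R_free n M \<longleftrightarrow>
    (\<exists>B \<subseteq> lcarrier M.
      (\<forall>m\<in>lcarrier M. \<exists>bs rs. distinct bs \<and> set bs \<subseteq> B \<and> length rs = length bs \<and>
          m = lcomb M (ract n M) (zip rs bs)) \<and>
      (\<forall>bs rs. distinct bs \<and> set bs \<subseteq> B \<and> length rs = length bs \<and>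
          lcomb M (ract n M) (zip rs bs) = lzero M \<longrightarrow> (\<forall>r\<in>set rs. r = 0)))"

definition CM_module :: "nat \<Rightarrow> ('k::field Kx mat, 'm) lmod \<Rightarrow> bool" where
  "CM_module n M \<longleftrightarrow> is_Lambda_module n M \<and> finitely_generated n M \<and> R_free n M"

definition submodule :: "nat \<Rightarrow> 'm set \<Rightarrow> ('k::field Kx mat, 'm) lmod \<Rightarrow> bool" where
  "submodule n N M \<longleftrightarrow> N \<subseteq> lcarrier M \<and> lzero M \<in> N \<and>
     (\<forall>a\<in>N. \<forall>b\<in>N. ladd M a b \<in> N) \<and> (\<forall>A\<in>Lambda n. \<forall>a\<in>N. lact M A a \<in> N)"

definition indecomposable :: "nat \<Rightarrow> ('k::field Kx mat, 'm) lmod \<Rightarrow> bool" where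
  "indecomposable n M \<longleftrightarrow> lcarrier M \<noteq> {lzero M} \<and>
     (\<forall>N1 N2. submodule n N1 M \<and> submodule n N2 M \<and> N1 \<inter> N2 = {lzero M} \<and>
        (\<forall>m\<in>lcarrier M. \<exists>a\<in>N1. \<exists>b\<in>N2. m = ladd M a b)
        \<longrightarrow> N1 = {lzero M} \<or> N2 = {lzero M})"

definition lmod_iso :: "nat \<Rightarrow> ('k::field Kx mat, 'm) lmod \<Rightarrow> ('k Kx mat, 'p) lmod \<Rightarrow> bool" where
  "lmod_iso n M N \<longleftrightarrow> (\<exists>f. bij_betw f (lcarrier M) (lcarrier N) \<and>
     (\<forall>a\<in>lcarrier M. \<forall>b\<in>lcarrier M. f (ladd M a b) = ladd N (f a) (f b)) \<and>
     (\<forall>A\<in>Lambda n. \<forall>a\<in>lcarrier M. f (lact M A a) = lact N A (f a)))"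

definition pexp :: "nat \<Rightarrow> nat \<Rightarrow> nat \<Rightarrow> int" where
  "pexp i j k = (if k \<le> i then 0 else if k \<le> j then 1 else 2)"

definition pair_set :: "nat \<Rightarrow> nat \<Rightarrow> nat \<Rightarrow> 'k::field Kx vec set" where
  "pair_set n i j = {v \<in> carrier_vec n. \<forall>k<n. in_xR (pexp i j (k+1)) (vec_index v k)}"

definition pair_module :: "nat \<Rightarrow> nat \<Rightarrow> nat \<Rightarrow> ('k::field Kx mat, 'k Kx vec) lmod" where
  "pair_module n i j = \<lparr> lcarrier = pair_set n i j, ladd = (+), lzero = 0\<^sub>v n,
      lact = (\<lambda>A v. A *\<^sub>v v) \<rparr>"

definition pair_index :: "nat \<Rightarrow> (nat \<times> nat) set" where
  "pair_index n = {(i, j). 1 \<le> i \<and> i < j \<and> j \<le> n}"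

definition dsum_module :: "nat \<Rightarrow> (nat \<times> nat \<Rightarrow> nat) \<Rightarrow>
    ('k::field Kx mat, nat \<times> nat \<times> nat \<Rightarrow> 'k Kx vec) lmod" where
  "dsum_module n l = \<lparr>
      lcarrier = {f. \<forall>i j t. (if (i, j) \<in> pair_index n \<and> t < l (i, j)
                               then f (i, j, t) \<in> pair_set n i j
                               else f (i, j, t) = 0\<^sub>v n)},
      ladd = (\<lambda>f g p. f p + g p),
      lzero = (\<lambda>p. 0\<^sub>v n),
      lact = (\<lambda>A f p. A *\<^sub>v f p) \<rparr>"

end

theory Submission
  imports Defs "HOL-Library.Function_Algebras" "HOL-Algebra.FiniteProduct"
begin

text \<open>A Cohen--Macaulay module \<open>M\<close> is torsion-free over \<open>R = K[x]\<close>, and is determined by the chain of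
  \<open>R\<close>-lattices \<open>L k = E\<^bsub>1k\<^esub> M\<close> inside the free module \<open>L 1\<close>, which satisfies \<open>L (k+1) \<subseteq> L k\<close>,
  \<open>x L k \<subseteq> L (k+1)\<close>, \<open>L n \<subseteq> x L 1\<close> and \<open>x\<^sup>2 L 1 \<subseteq> L n\<close>. For \<open>v \<in> L 1\<close> count the \<open>k\<close> with \<open>v \<in> L k\<close> and
  the \<open>k\<close> with \<open>x v \<in> L k\<close>. An \<open>R\<close>-basis of \<open>L 1\<close> maximizing the sum of all these counts is
  adapted to every \<open>L k\<close> simultaneously, and a basis vector with counts \<open>i < j\<close> spans a summand \<open>(i, j)\<close>.
  Multiplicities are recovered from dimensions of subquotients of \<open>L 1 / x L 1\<close>. The module \<open>(i, j)\<close> is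
  indecomposable because it has rank one: two nonzero submodules contain a common nonzero
  multiple of the first unit vector.\<close>

section \<open>Bases adapted to a chain of lattices\<close>

text \<open>Why two counts per vector suffice: as \<open>L n\<close> contains
  \<open>x^2 L 1\<close>, the condition that \<open>x v\<close> lies in \<open>L k\<close> depends
  only on \<open>v\<close> modulo \<open>x L 1\<close>. So membership of \<open>v\<close> and of
  \<open>x v\<close> in the \<open>L k\<close> induces two flags in the K-vector space
  \<open>L 1 / x L 1\<close>. Two flags always have a common adapted basis, while three in general
  do not. This is why the summands are labelled by pairs, and why intersections of one step of each
  flag recover the multiplicities. The extremal basis avoids constructing the flags and lifting from
  residues. A vector that violates adaptedness yields a combination whose coefficient at some
  \<open>b i\<close> is a nonzero constant, a unit of K[x]; exchanging it for \<open>b i\<close>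
  keeps a basis and raises the sum of counts. The inequality \<open>i < j\<close> comes from the two
  remaining relations: \<open>L n\<close> inside \<open>x L 1\<close> keeps basis vectors out of
  \<open>L n\<close>, and \<open>x L k\<close> inside \<open>L (k+1)\<close> lets \<open>x v\<close>
  go at least one step further than \<open>v\<close>.\<close>

locale torsion_free_poly_module = Modules.module scale
  for scale :: "'k::field poly \<Rightarrow> 'v::ab_group_add \<Rightarrow> 'v" (infixr \<open>*s\<close> 75) +
  assumes torsion_free: "r *s v = 0 \<Longrightarrow> r = 0 \<or> v = 0"
begin

text \<open>Bases are indexed families, not sets of vectors, so that exchanging a vector is the
  update \<open>b(i := w)\<close>. Only the values of \<open>p\<close> on \<open>I\<close>
  matter.\<close>

definition lin :: "'i set \<Rightarrow> ('i \<Rightarrow> 'v) \<Rightarrow> ('i \<Rightarrow> 'k poly) \<Rightarrow> 'v" where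
  "lin I b p = (\<Sum>i\<in>I. p i *s b i)"

definition lin_independent :: "'i set \<Rightarrow> ('i \<Rightarrow> 'v) \<Rightarrow> bool" where
  "lin_independent I b \<longleftrightarrow> (\<forall>p. lin I b p = 0 \<longrightarrow> (\<forall>i\<in>I. p i = 0))"

lemma lin_cong: "(\<And>i. i \<in> I \<Longrightarrow> p i = q i) \<Longrightarrow> lin I b p = lin I b q"
  unfolding lin_def by (rule sum.cong) auto

lemma lin_add: "lin I b (\<lambda>i. p i + q i) = lin I b p + lin I b q"
  by (simp add: lin_def scale_left_distrib sum.distrib)

lemma lin_diff: "lin I b (\<lambda>i. p i - q i) = lin I b p - lin I b q"
  by (simp add: lin_def scale_left_diff_distrib sum_subtractf)

lemma lin_scale: "lin I b (\<lambda>i. r * p i) = r *s lin I b p"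
  by (simp add: lin_def scale_sum_right)

lemma lin_single: "finite I \<Longrightarrow> i \<in> I \<Longrightarrow> lin I b (\<lambda>j. if j = i then r else 0) = r *s b i"
  by (simp add: lin_def if_distrib[of "\<lambda>r. r *s _"] cong: if_cong)

lemma lin_remove: "finite I \<Longrightarrow> b i = 0 \<Longrightarrow> lin I b p = lin (I - {i}) b p"
  unfolding lin_def by (rule sum.mono_neutral_right) auto

lemma lin_mem: "subspace S \<Longrightarrow> (\<And>i. i \<in> I \<Longrightarrow> p i *s b i \<in> S) \<Longrightarrow> lin I b p \<in> S"
  unfolding lin_def by (rule subspace_sum)

lemma lin_upd:
  assumes "finite I" "i \<in> I"
  shows "lin I (b(i := w)) p = lin I b (p(i := 0)) + p i *s w"
proof -
  have "lin I (b(i := w)) p = p i *s w + (\<Sum>j\<in>I-{i}. p j *s b j)"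
    unfolding lin_def using assms by (simp add: sum.remove[of I i])
  moreover have "lin I b (p(i := 0)) = (\<Sum>j\<in>I-{i}. p j *s b j)"
    unfolding lin_def using assms by (simp add: sum.remove[of I i])
  ultimately show ?thesis by simp
qed

lemma lin_upd_lin:
  assumes "finite I" "i \<in> I"
  shows "lin I (b(i := lin I b q)) p = lin I b (\<lambda>j. (p(i := 0)) j + p i * q j)"
  unfolding lin_upd[OF assms] lin_add lin_scale ..

text \<open>The coefficient \<open>q i\<close> is a unit of K[x], so the old vector
  \<open>b i\<close> can be recovered from the new one.\<close>

lemma range_lin_replace:
  assumes I: "finite I" "i \<in> I" and q: "q i = [:c:]" "c \<noteq> 0"
  shows "range (lin I (b(i := lin I b q))) = range (lin I b)"
proof -
  let ?b = "b(i := lin I b q)"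
  \<comment> \<open>The inverse change of coordinates: the new vector takes the coefficient
    \<open>p i / c\<close>, and its contribution to every other coordinate is subtracted.\<close>
  have "lin I b p = lin I ?b (\<lambda>j. if j = i then p i * [:1/c:] else p j - p i * [:1/c:] * q j)" for p
    unfolding lin_upd_lin[OF I]
  proof (rule lin_cong)
    fix j
    show "p j = ((\<lambda>j. if j = i then p i * [:1/c:] else p j - p i * [:1/c:] * q j)(i := 0)) j
        + (if i = i then p i * [:1/c:] else p i - p i * [:1/c:] * q i) * q j"
      using q by (cases "j = i") (auto simp: mult.assoc)
  qed
  then have "range (lin I b) \<subseteq> range (lin I ?b)" by blast
  moreover have "range (lin I ?b) \<subseteq> range (lin I b)"
    unfolding lin_upd_lin[OF I] by blast
  ultimately show ?thesis by blast
qed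

text \<open>The equation at \<open>i\<close> reads \<open>p i * q i = 0\<close>, and K[x] is a
  domain; with \<open>p i = 0\<close> the relation is one among the old vectors.\<close>

lemma lin_independent_replace:
  assumes I: "finite I" "i \<in> I" and q: "q i \<noteq> 0" and b: "lin_independent I b"
  shows "lin_independent I (b(i := lin I b q))"
  unfolding lin_independent_def
proof (intro allI impI)
  fix p assume "lin I (b(i := lin I b q)) p = 0"
  then have *: "(p(i := 0)) j + p i * q j = 0" if "j \<in> I" for j
    using that b unfolding lin_upd_lin[OF I] lin_independent_def by blast
  from *[OF I(2)] have "p i = 0" using q by simp
  with * show "\<forall>j\<in>I. p j = 0" by (metis add.right_neutral fun_upd_other mult_zero_left)
qed

text \<open>In a generating family of minimal cardinality there is no relation: Euclidean division by a
  nonzero coefficient of least degree would turn it into \<open>r *s v = 0\<close> for a generator \<open>v\<close>.\<close>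

lemma basis_exists:
  assumes "finite X"
  shows "\<exists>(I :: 'v set) b. finite I \<and> range (lin I b) = span X \<and> lin_independent I b"
proof -
  define P where "P I \<longleftrightarrow> finite I \<and> (\<exists>b. range (lin I b) = span X)" for I :: "'v set"
  \<comment> \<open>Indices are taken from the type of vectors so that \<open>X\<close> can index
    itself by the identity.\<close>
  have "P X"
    unfolding P_def lin_def by (intro conjI exI[of _ "\<lambda>v. v"]) (simp_all add: assms span_finite)
  then obtain I where I: "P I" and min: "\<And>J. P J \<Longrightarrow> card I \<le> card J"
    using ex_has_least_nat[of P X card] by blast
  have fin: "finite I" using I by (simp add: P_def)
  have no_rel: False if "range (lin I b) = span X" "lin I b p = 0" "i \<in> I" "p i \<noteq> 0" for b p i
    using that
  proof (induction "degree (p i)" arbitrary: b p i rule: less_induct)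
    case less
    \<comment> \<open>Absorbing the quotients into the vector at \<open>i\<close> leaves
      \<open>p i\<close> there and turns every other coefficient of the relation into its remainder
      modulo \<open>p i\<close>.\<close>
    define q where "q j = (if j = i then 1 else p j div p i)" for j
    define p' where "p' j = (if j = i then p i else p j mod p i)" for j
    let ?b = "b(i := lin I b q)"
    have gen: "range (lin I ?b) = span X"
      using range_lin_replace[OF fin less.prems(3), of q 1 b] less.prems(1) by (simp add: q_def one_pCons)
    have "lin I ?b p' = lin I b p"
      unfolding lin_upd_lin[OF fin less.prems(3)]
    proof (rule lin_cong)
      fix j
      show "(p'(i := 0)) j + p' i * q j = p j"
        by (cases "j = i") (simp_all add: p'_def q_def mod_mult_div_eq)
    qed
    then have rel: "lin I ?b p' = 0" using less.prems(2) by simp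
    show False
    proof (cases "\<exists>j\<in>I. j \<noteq> i \<and> p' j \<noteq> 0")
      case True
      then obtain j where j: "j \<in> I" "j \<noteq> i" "p' j \<noteq> 0" by blast
      then have "degree (p' j) < degree (p i)"
        using less.prems(4) degree_mod_less[of "p i" "p j"] by (auto simp: p'_def)
      from less.hyps[OF this gen rel j(1,3)] show False .
    next
      case False
      then have "lin I ?b p' = lin I ?b (\<lambda>j. if j = i then p i else 0)"
        by (intro lin_cong) (auto simp: p'_def)
      also have "\<dots> = p i *s ?b i" by (rule lin_single[OF fin less.prems(3)])
      finally have "p i *s ?b i = 0" using rel by simp
      then have bi: "?b i = 0" using torsion_free less.prems(4) by blast
      \<comment> \<open>All remainders vanished, so torsion-freeness killed the new vector at
        \<open>i\<close>; dropping it contradicts minimality of \<open>card I\<close>.\<close>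
      have "lin I ?b r = lin (I - {i}) ?b r" for r
        by (rule lin_remove[where b = ?b and i = i, OF fin bi])
      then have "P (I - {i})" using gen fin unfolding P_def by (metis finite_Diff image_cong)
      from min[OF this] show False using fin less.prems(3)
        by (metis card_Diff1_less leD)
    qed
  qed
  from I obtain b where b: "range (lin I b) = span X" by (auto simp: P_def)
  with no_rel have "lin_independent I b" unfolding lin_independent_def by blast
  with b fin show ?thesis by blast
qed

end

text \<open>A downward closed set of numbers below \<open>n\<close> is an initial segment, so its
  cardinality alone decides membership. This makes the counts \<open>lev\<close> and
  \<open>xlev\<close> equivalent to the full list of memberships.\<close>

lemma card_initial_segment_iff:
  assumes "\<And>k. Suc k < n \<Longrightarrow> P (Suc k) \<Longrightarrow> P k" "k < n"
  shows "k < card {k. k < n \<and> P k} \<longleftrightarrow> P k"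
proof -
  have down: "P j" if "P k" "j \<le> k" "k < n" for j k
    using that(2,1,3) by (induction rule: inc_induct) (use assms(1) in auto)
  show ?thesis
  proof
    assume "P k"
    then have "{..k} \<subseteq> {k. k < n \<and> P k}" using down assms(2) by auto
    then have "card {..k} \<le> card {k. k < n \<and> P k}" by (intro card_mono) auto
    then show "k < card {k. k < n \<and> P k}" by simp
  next
    assume *: "k < card {k. k < n \<and> P k}"
    show "P k"
    proof (rule ccontr)
      assume "\<not> P k"
      have "j < k" if "j < n" "P j" for j
        by (rule ccontr) (use down[of j k] that \<open>\<not> P k\<close> in simp)
      then have "{k. k < n \<and> P k} \<subseteq> {..<k}" by blast
      then have "card {k. k < n \<and> P k} \<le> card {..<k}" by (intro card_mono) auto
      with * show False by simp
    qed
  qed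
qed

section \<open>Exponents 0, 1, 2 read off from the two lowest coefficients\<close>

abbreviation polX :: "'k::field poly" where "polX \<equiv> [:0, 1:]"

lemma polX_dvd: "coeff p 0 = 0 \<Longrightarrow> polX dvd p"
  by (cases p) (auto intro!: dvdI)

lemma polX2_dvd: 
  assumes "coeff p 0 = 0" "coeff p 1 = 0" shows "polX\<^sup>2 dvd p"
proof -
  obtain r where p: "p = polX * r" using polX_dvd[OF assms(1)] by blast
  with assms(2) have "coeff r 0 = 0" by simp
  then show ?thesis unfolding p power2_eq_square by (intro mult_dvd_mono dvd_refl polX_dvd)
qed

text \<open>This is \<open>pexp\<close> with zero-based \<open>k\<close> and natural values. For
  \<open>v\<close> in \<open>L 0\<close> with counts \<open>f\<close> and \<open>g\<close> it is the
  least power of x that carries \<open>v\<close> into \<open>L k\<close>.\<close>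

definition pexpn :: "nat \<Rightarrow> nat \<Rightarrow> nat \<Rightarrow> nat" where
  "pexpn f g k = (if k < f then 0 else if k < g then 1 else 2)"

text \<open>Splits the divisibility into conditions on the coefficients 0 and 1, which the exchange
  argument establishes one after the other.\<close>

lemma polX_power_pexpn_dvd:
  assumes "f \<le> k \<Longrightarrow> coeff p 0 = 0" "f \<le> k \<Longrightarrow> g \<le> k \<Longrightarrow> coeff p 1 = 0"
  shows "polX ^ pexpn f g k dvd p"
  using assms polX_dvd[of p] polX2_dvd[of p] by (auto simp: pexpn_def)

text \<open>Indices are zero-based as in the matrices: \<open>L 0\<close> and
  \<open>L (n - 1)\<close> are the first and the last lattice.\<close>

locale lattice_chain = torsion_free_poly_module scale
  for scale :: "'k::field poly \<Rightarrow> 'v::ab_group_add \<Rightarrow> 'v" (infixr \<open>*s\<close> 75) +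
  fixes L :: "nat \<Rightarrow> 'v set" and n :: nat and X :: "'v set"
  assumes n: "2 \<le> n"
    and subspace_L: "k < n \<Longrightarrow> subspace (L k)"
    and L_dec: "Suc k < n \<Longrightarrow> L (Suc k) \<subseteq> L k"
    and x_L: "Suc k < n \<Longrightarrow> v \<in> L k \<Longrightarrow> polX *s v \<in> L (Suc k)"
    and L_last: "v \<in> L (n - 1) \<Longrightarrow> \<exists>w \<in> L 0. v = polX *s w"
    and x2_L: "v \<in> L 0 \<Longrightarrow> polX\<^sup>2 *s v \<in> L (n - 1)"
    and fin_X: "finite X" and L_gen: "L 0 = span X"
begin

definition lev :: "'v \<Rightarrow> nat" where "lev v = card {k. k < n \<and> v \<in> L k}"
definition xlev :: "'v \<Rightarrow> nat" where "xlev v = card {k. k < n \<and> polX *s v \<in> L k}"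

lemma less_lev_iff: "k < n \<Longrightarrow> k < lev v \<longleftrightarrow> v \<in> L k"
  unfolding lev_def by (rule card_initial_segment_iff) (use L_dec in auto)

lemma less_xlev_iff: "k < n \<Longrightarrow> k < xlev v \<longleftrightarrow> polX *s v \<in> L k"
  unfolding xlev_def by (rule card_initial_segment_iff) (use L_dec in auto)

lemma lev_le: "lev v \<le> n" and xlev_le: "xlev v \<le> n"
proof -
  show "lev v \<le> n" unfolding lev_def by (rule order_trans[OF card_mono[of "{..<n}"]]) auto
  show "xlev v \<le> n" unfolding xlev_def by (rule order_trans[OF card_mono[of "{..<n}"]]) auto
qed

lemma lev_leI: "(\<And>k. k < n \<Longrightarrow> u \<in> L k \<Longrightarrow> v \<in> L k) \<Longrightarrow> lev u \<le> lev v"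
  unfolding lev_def by (rule card_mono) auto

lemma xlev_leI: "(\<And>k. k < n \<Longrightarrow> polX *s u \<in> L k \<Longrightarrow> polX *s v \<in> L k) \<Longrightarrow> xlev u \<le> xlev v"
  unfolding xlev_def by (rule card_mono) auto

lemma L_antimono: "j \<le> k \<Longrightarrow> k < n \<Longrightarrow> L k \<subseteq> L j"
  by (induction rule: inc_induct) (use L_dec in force)+

lemma x2_mult_L: 
  assumes "v \<in> L 0" "k < n" "polX\<^sup>2 dvd p" shows "p *s v \<in> L k"
proof -
  obtain r where r: "p = r * polX\<^sup>2" using assms(3) by (auto elim: dvdE simp: mult.commute)
  have "polX\<^sup>2 *s v \<in> L k" using x2_L[OF assms(1)] L_antimono[of k "n-1"] assms(2) by fastforce
  then have "r *s (polX\<^sup>2 *s v) \<in> L k" by (rule subspace_scale[OF subspace_L[OF assms(2)]])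
  then show ?thesis by (simp only: scale_scale r)
qed

text \<open>The half of adaptedness that holds for every vector of \<open>L 0\<close>, without any
  choice of a basis.\<close>

lemma scale_mem_L:
  assumes "v \<in> L 0" "k < n" "polX ^ pexpn (lev v) (xlev v) k dvd p"
  shows "p *s v \<in> L k"
proof -
  consider "k < lev v" | "k < xlev v" "polX dvd p" | "polX\<^sup>2 dvd p"
    using assms(3) by (auto simp: pexpn_def split: if_splits)
  then show ?thesis
  proof cases
    case 1 then show ?thesis
      using less_lev_iff[OF assms(2)] subspace_scale[OF subspace_L[OF assms(2)]] by blast
  next
    case 2
    then obtain r where "p = r * polX" by (auto elim: dvdE simp: mult.commute)
    moreover have "r *s (polX *s v) \<in> L k" 
      using 2 less_xlev_iff[OF assms(2)] subspace_scale[OF subspace_L[OF assms(2)]] by blast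
    ultimately show ?thesis by (simp only: scale_scale)
  next
    case 3 then show ?thesis using x2_mult_L assms by blast
  qed
qed

text \<open>A basis of \<open>L 0\<close> maximizing the sum of all \<open>lev\<close> and \<open>xlev\<close> is adapted to the whole chain: an
  element of \<open>L k\<close> violating this could replace one of the basis vectors and increase the sum.\<close>

lemma adapted_basis:
  obtains I :: "'v set" and b where "finite I" "range (lin I b) = L 0" "lin_independent I b"
    "\<And>i. i \<in> I \<Longrightarrow> 1 \<le> lev (b i) \<and> lev (b i) < xlev (b i) \<and> xlev (b i) \<le> n"
    "\<And>k p. k < n \<Longrightarrow> lin I b p \<in> L k \<longleftrightarrow> (\<forall>i\<in>I. polX ^ pexpn (lev (b i)) (xlev (b i)) k dvd p i)"
proof -
  obtain I :: "'v set" and b0 where fin: "finite I" and b0: "range (lin I b0) = L 0" "lin_independent I b0"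
    using basis_exists[OF fin_X] unfolding L_gen by blast
  define Q where "Q b \<longleftrightarrow> range (lin I b) = L 0 \<and> lin_independent I b" for b
  define \<mu> where "\<mu> b = (\<Sum>i\<in>I. lev (b i) + xlev (b i))" for b
  have "\<mu> b \<le> card I * (n + n)" for b
    unfolding \<mu>_def using sum_bounded_above[of I "\<lambda>i. lev (b i) + xlev (b i)" "n + n"] lev_le xlev_le
    by (simp add: add_mono)
  then have bound: "\<forall>b. Q b \<longrightarrow> \<mu> b < Suc (card I * (n + n))" by (simp add: le_imp_less_Suc)
  have Q0: "Q b0" using b0 by (simp add: Q_def)
  obtain b where b: "Q b" and max: "\<And>b'. Q b' \<Longrightarrow> \<mu> b' \<le> \<mu> b"
    using ex_has_greatest_nat[of Q b0 \<mu>, OF Q0 bound] by blast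
  have gen: "range (lin I b) = L 0" and ind: "lin_independent I b" using b by (auto simp: Q_def)
  \<comment> \<open>Maximality in the form used below: a combination with a nonzero constant at
    \<open>i\<close> could take the place of \<open>b i\<close>.\<close>
  have no_gain: "lev (lin I b q) + xlev (lin I b q) \<le> lev (b i) + xlev (b i)"
    if "i \<in> I" "q i = [:c:]" "c \<noteq> 0" for q i c
  proof -
    have "Q (b(i := lin I b q))"
      unfolding Q_def using range_lin_replace[OF fin, of i q c b] lin_independent_replace[OF fin, of i q b] that gen ind
      by simp
    from max[OF this] show ?thesis
      unfolding \<mu>_def sum.remove[OF fin that(1)] by simp
  qed
  have bL: "b i \<in> L 0" if "i \<in> I" for i
    using gen lin_single[OF fin that, of b 1] by (metis rangeI scale_one)
  have coeff0: "coeff (p i) 0 = 0" if k: "k < n" and v: "lin I b p \<in> L k" and i: "i \<in> I" "lev (b i) \<le> k" for p k i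
  proof (rule ccontr)
    assume ne: "coeff (p i) 0 \<noteq> 0"
    \<comment> \<open>All violating indices are treated together. The one with least
      \<open>xlev\<close> is exchanged, so that the others in \<open>J\<close> do not lower
      \<open>xlev\<close>.\<close>
    define J where "J = {i \<in> I. lev (b i) \<le> k \<and> coeff (p i) 0 \<noteq> 0}"
    have "i \<in> J" using i ne by (simp add: J_def)
    then obtain i where i: "i \<in> J" and imin: "\<And>j. j \<in> J \<Longrightarrow> xlev (b i) \<le> xlev (b j)"
      using ex_has_least_nat[of "\<lambda>i. i \<in> J" _ "\<lambda>i. xlev (b i)"] by blast
    define c where "c = coeff (p i) 0"
    \<comment> \<open>The inverse of \<open>p i\<close> modulo \<open>x^2\<close> up to the factor
      \<open>c\<close>: the product \<open>e * p i\<close> is congruent to the constant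
      \<open>c\<close>.\<close>
    define e where "e = [:1, - coeff (p i) 1 / c:]"
    have c: "c \<noteq> 0" using i by (simp add: J_def c_def)
    have iI: "i \<in> I" "lev (b i) \<le> k" using i by (auto simp: J_def)
    \<comment> \<open>From \<open>e\<close> times the given vector, drop the terms with
      \<open>b j\<close> already in \<open>L k\<close> and reduce the coefficient at
      \<open>i\<close> modulo \<open>x^2\<close>. Both changes stay inside \<open>L k\<close>, so
      the result is in \<open>L k\<close> and \<open>lev\<close> rises above that of
      \<open>b i\<close>.\<close>
    define q where "q j = (if j = i then [:c:] else if k < lev (b j) then 0 else e * p j)" for j
    have "e *s lin I b p - lin I b q = lin I b (\<lambda>j. e * p j - q j)"
      by (simp add: lin_scale lin_diff)
    also have "\<dots> \<in> L k"
    proof (rule lin_mem[OF subspace_L[OF k]])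
      fix j assume j: "j \<in> I"
      have "polX\<^sup>2 dvd e * p i - [:c:]"
        by (rule polX2_dvd) (use c in \<open>simp_all add: e_def c_def coeff_mult\<close>)
      then show "(e * p j - q j) *s b j \<in> L k"
        using scale_mem_L[OF bL[OF j] k] x2_mult_L[OF bL[OF j] k]
        by (auto simp: q_def pexpn_def)
    qed
    finally have "e *s lin I b p - (e *s lin I b p - lin I b q) \<in> L k"
      using subspace_diff[OF subspace_L[OF k]] subspace_scale[OF subspace_L[OF k]] v by blast
    then have "lin I b q \<in> L k" by simp
    then have "lev (b i) < lev (lin I b q)" using less_lev_iff[OF k] iI(2) by (metis le_less_trans)
    \<comment> \<open>Terms in \<open>J\<close> are controlled by the choice of \<open>i\<close>.
      Any other surviving coefficient is divisible by x, hence by \<open>x^2\<close> after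
      multiplication by x, and such terms lie in every lattice.\<close>
    moreover have "xlev (b i) \<le> xlev (lin I b q)"
    proof (rule xlev_leI)
      fix l assume l: "l < n" "polX *s b i \<in> L l"
      have "lin I b (\<lambda>j. polX * q j) \<in> L l"
      proof (rule lin_mem[OF subspace_L[OF l(1)]])
        fix j assume j: "j \<in> I"
        have "j \<noteq> i" if "j \<notin> J" using that i by auto
        moreover have "coeff (p j) 0 = 0" if "j \<notin> J" "\<not> k < lev (b j)"
          using that j by (auto simp: J_def)
        ultimately consider "j \<in> J" | "j \<notin> J" "k < lev (b j)" "j \<noteq> i" | "j \<notin> J" "coeff (p j) 0 = 0" "\<not> k < lev (b j)" "j \<noteq> i" 
          by blast
        then show "(polX * q j) *s b j \<in> L l"
        proof cases
          case 1
          then have "polX *s b j \<in> L l" using imin[OF 1] l less_xlev_iff[OF l(1)] by (meson order_less_le_trans)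
          then have "q j *s (polX *s b j) \<in> L l" by (rule subspace_scale[OF subspace_L[OF l(1)]])
          then show ?thesis by (simp only: scale_scale mult.commute)
        next
          case 2 then show ?thesis using subspace_0[OF subspace_L[OF l(1)]] by (simp add: q_def)
        next
          case 3
          then have "polX dvd q j" using polX_dvd[of "p j"] by (simp add: q_def dvd_mult)
          then have "polX\<^sup>2 dvd polX * q j" unfolding power2_eq_square by (rule mult_dvd_mono[OF dvd_refl])
          then show ?thesis by (rule x2_mult_L[OF bL[OF j] l(1)])
        qed
      qed
      then show "polX *s lin I b q \<in> L l" by (simp only: lin_scale)
    qed
    moreover have "q i = [:c:]" by (simp add: q_def)
    ultimately show False using no_gain[OF iI(1) _ c, of q] by linarith
  qed
  have coeff1: "coeff (p i) 1 = 0" if k: "k < n" and v: "lin I b p \<in> L k"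
    and i: "i \<in> I" "lev (b i) \<le> k" "xlev (b i) \<le> k" for p k i
  proof (rule ccontr)
    assume ne: "coeff (p i) 1 \<noteq> 0"
    \<comment> \<open>The same exchange with the two counts in opposite roles: \<open>i\<close> has
      least \<open>lev\<close>, and \<open>xlev\<close> will increase.\<close>
    define J where "J = {i \<in> I. lev (b i) \<le> k \<and> xlev (b i) \<le> k \<and> coeff (p i) 1 \<noteq> 0}"
    have "i \<in> J" using i ne by (simp add: J_def)
    then obtain i where i: "i \<in> J" and imin: "\<And>j. j \<in> J \<Longrightarrow> lev (b i) \<le> lev (b j)"
      using ex_has_least_nat[of "\<lambda>i. i \<in> J" _ "\<lambda>i. lev (b i)"] by blast
    have iI: "i \<in> I" "xlev (b i) \<le> k" "coeff (p i) 1 \<noteq> 0" using i by (auto simp: J_def)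
    \<comment> \<open>By \<open>coeff0\<close> the constant terms at indices with
      \<open>lev (b j) \<le> k\<close> are gone. The violating linear terms are therefore, modulo
      \<open>L k\<close>, x times a combination with constant coefficients.\<close>
    define q where "q j = (if j \<in> J then [:coeff (p j) 1:] else 0)" for j
    have "lin I b p - polX *s lin I b q = lin I b (\<lambda>j. p j - polX * q j)"
      unfolding lin_diff lin_scale ..
    also have "\<dots> \<in> L k"
    proof (rule lin_mem[OF subspace_L[OF k]])
      fix j assume j: "j \<in> I"
      show "(p j - polX * q j) *s b j \<in> L k"
      proof (rule scale_mem_L[OF bL[OF j] k], rule polX_power_pexpn_dvd)
        show "coeff (p j - polX * q j) 0 = 0" if "lev (b j) \<le> k"
          using coeff0[OF k v j that] by simp
        show "coeff (p j - polX * q j) 1 = 0" if "lev (b j) \<le> k" "xlev (b j) \<le> k"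
          using that j by (auto simp: q_def J_def)
      qed
    qed
    finally have "lin I b p - (lin I b p - polX *s lin I b q) \<in> L k"
      using subspace_diff[OF subspace_L[OF k]] v by blast
    then have "polX *s lin I b q \<in> L k" by simp
    then have "xlev (b i) < xlev (lin I b q)" using less_xlev_iff[OF k] iI(2) by (metis le_less_trans)
    moreover have "lev (b i) \<le> lev (lin I b q)"
    proof (rule lev_leI)
      fix l assume l: "l < n" "b i \<in> L l"
      show "lin I b q \<in> L l"
      proof (rule lin_mem[OF subspace_L[OF l(1)]])
        fix j assume j: "j \<in> I"
        have "b j \<in> L l" if "j \<in> J"
          using imin[OF that] l less_lev_iff[OF l(1)] by (meson order_less_le_trans)
        then show "q j *s b j \<in> L l"
          using subspace_scale[OF subspace_L[OF l(1)]] subspace_0[OF subspace_L[OF l(1)]] by (auto simp: q_def)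
      qed
    qed
    moreover have "q i = [:coeff (p i) 1:]" using i by (simp add: q_def)
    ultimately show False using no_gain[OF iI(1) _ iI(3), of q] by linarith
  qed
  have iff: "lin I b p \<in> L k \<longleftrightarrow> (\<forall>i\<in>I. polX ^ pexpn (lev (b i)) (xlev (b i)) k dvd p i)" if k: "k < n" for k p
  proof
    assume "lin I b p \<in> L k"
    then show "\<forall>i\<in>I. polX ^ pexpn (lev (b i)) (xlev (b i)) k dvd p i"
      using coeff0[OF k] coeff1[OF k] by (intro ballI polX_power_pexpn_dvd)
  next
    assume "\<forall>i\<in>I. polX ^ pexpn (lev (b i)) (xlev (b i)) k dvd p i"
    then show "lin I b p \<in> L k" using scale_mem_L bL k by (intro lin_mem[OF subspace_L[OF k]]) blast
  qed
  have rng: "1 \<le> lev (b i) \<and> lev (b i) < xlev (b i) \<and> xlev (b i) \<le> n" if i: "i \<in> I" for i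
  proof (intro conjI)
    show f1: "1 \<le> lev (b i)" using bL[OF i] less_lev_iff[of 0 "b i"] n by simp
    \<comment> \<open>A basis vector cannot be x times an element of \<open>L 0\<close>: comparing
      coordinates at \<open>i\<close> would make x a unit.\<close>
    have "\<not> n - 1 < lev (b i)"
    proof
      assume "n - 1 < lev (b i)"
      then obtain w where w: "w \<in> L 0" "b i = polX *s w" using less_lev_iff[of "n-1" "b i"] n L_last by auto
      then obtain p where p: "w = lin I b p" using gen by (auto simp: image_iff)
      have "b i = lin I b (\<lambda>j. if j = i then 1 else 0)" using lin_single[OF fin i, of b 1] by simp
      with p w(2) have "lin I b (\<lambda>j. (if j = i then 1 else 0) - polX * p j) = 0"
        unfolding lin_diff lin_scale by simp
      with ind i have "1 - polX * p i = 0" unfolding lin_independent_def by fastforce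
      then have "coeff (1 - polX * p i) 0 = 0" by (metis coeff_0)
      then show False by simp
    qed
    then have "Suc (lev (b i) - 1) < n" using n f1 by linarith
    moreover have "b i \<in> L (lev (b i) - 1)" using less_lev_iff[of "lev (b i) - 1" "b i"] f1 calculation by linarith
    ultimately have "polX *s b i \<in> L (lev (b i))" using x_L[of "lev (b i) - 1" "b i"] f1 by simp
    then show "lev (b i) < xlev (b i)" using less_xlev_iff[of "lev (b i)" "b i"] \<open>Suc (lev (b i) - 1) < n\<close> f1 by simp
    show "xlev (b i) \<le> n" by (rule xlev_le)
  qed
  show ?thesis by (rule that[OF fin gen ind rng iff])
qed

end

text \<open>Numbering each fibre of the pair of labels relabels an arbitrary finite index set by the
  triples that index the summands of \<open>dsum_module\<close>.\<close>

lemma fibre_enumeration: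
  assumes "finite I"
  obtains h where "bij_betw h {(i, j, t). t < card {s \<in> I. \<phi> s = i \<and> \<psi> s = j}} I"
    "\<And>i j t. t < card {s \<in> I. \<phi> s = i \<and> \<psi> s = j} \<Longrightarrow> \<phi> (h (i, j, t)) = i \<and> \<psi> (h (i, j, t)) = j"
proof -
  define F where "F i j = {s \<in> I. \<phi> s = i \<and> \<psi> s = j}" for i j
  have "\<exists>e. bij_betw e {0..<card (F i j)} (F i j)" for i j
    using assms by (intro ex_bij_betw_nat_finite) (simp add: F_def)
  then obtain e where e: "\<And>i j. bij_betw (e i j) {0..<card (F i j)} (F i j)" by metis
  have eF: "e i j t \<in> F i j" if "t < card (F i j)" for i j t
    using bij_betwE[OF e[of i j]] that by simp
  define h where "h = (\<lambda>(i, j, t). e i j t)"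
  show thesis
  proof
    show "bij_betw h {(i, j, t). t < card {s \<in> I. \<phi> s = i \<and> \<psi> s = j}} I"
      unfolding F_def[symmetric]
    proof (rule bij_betw_imageI)
      show "inj_on h {(i, j, t). t < card (F i j)}"
      proof (clarsimp simp: inj_on_def h_def)
        fix i j t i' j' t'
        assume *: "t < card (F i j)" "t' < card (F i' j')" "e i j t = e i' j' t'"
        then have ij: "i = i' \<and> j = j'"
          using eF[OF *(1)] eF[OF *(2)] by (simp add: F_def)
        then show "i = i' \<and> j = j' \<and> t = t'"
          using inj_onD[OF bij_betw_imp_inj_on[OF e[of i j]], of t t'] * by simp
      qed
      show "h ` {(i, j, t). t < card (F i j)} = I"
      proof
        show "h ` {(i, j, t). t < card (F i j)} \<subseteq> I" using eF by (auto simp: h_def F_def)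
        show "I \<subseteq> h ` {(i, j, t). t < card (F i j)}"
        proof
          fix s assume "s \<in> I"
          then have "s \<in> F (\<phi> s) (\<psi> s)" by (simp add: F_def)
          then obtain t where "t < card (F (\<phi> s) (\<psi> s))" "s = e (\<phi> s) (\<psi> s) t"
            using bij_betw_imp_surj_on[OF e[of "\<phi> s" "\<psi> s"]] by (force simp: image_iff)
          then show "s \<in> h ` {(i, j, t). t < card (F i j)}"
            by (intro image_eqI[of _ _ "(\<phi> s, \<psi> s, t)"]) (auto simp: h_def)
        qed
      qed
    qed
  next
    show "\<phi> (h (i, j, t)) = i \<and> \<psi> (h (i, j, t)) = j" if "t < card {s \<in> I. \<phi> s = i \<and> \<psi> s = j}" for i j t
      using eF[of t i j] that by (simp add: h_def F_def)
  qed
qed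

section \<open>Indexing an adapted basis by the summands of a direct sum\<close>

definition dsum_index :: "nat \<Rightarrow> (nat \<times> nat \<Rightarrow> nat) \<Rightarrow> (nat \<times> nat \<times> nat) set" where
  "dsum_index n l = {(i, j, t). (i, j) \<in> pair_index n \<and> t < l (i, j)}"

lemma finite_pair_index [simp]: "finite (pair_index n)"
  by (rule finite_subset[of _ "{..n} \<times> {..n}"]) (auto simp: pair_index_def)

lemma dsum_index_conv_image: "dsum_index n l = (\<lambda>((i, j), t). (i, j, t)) ` (SIGMA p:pair_index n. {..<l p})"
  by (force simp: dsum_index_def)

lemma finite_dsum_index [simp]: "finite (dsum_index n l)"
  unfolding dsum_index_conv_image by auto

text \<open>The multiplicity of \<open>(i, j)\<close> is the number of adapted basis vectors with
  \<open>lev\<close> equal to \<open>i\<close> and \<open>xlev\<close> equal to \<open>j\<close>;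
  the range of these counts makes it vanish off \<open>pair_index n\<close>.\<close>

lemma (in lattice_chain) adapted_indexed_basis:
  obtains l b where "\<And>p. p \<notin> pair_index n \<Longrightarrow> l p = 0"
    "range (lin (dsum_index n l) b) = L 0" "lin_independent (dsum_index n l) b"
    "\<And>k p. k < n \<Longrightarrow> lin (dsum_index n l) b p \<in> L k \<longleftrightarrow>
      (\<forall>(i, j, t)\<in>dsum_index n l. polX ^ pexpn i j k dvd p (i, j, t))"
proof (rule adapted_basis)
  fix I :: "'v set" and b
  assume fin: "finite I" and gen: "range (lin I b) = L 0" and ind: "lin_independent I b"
    and rng: "\<And>i. i \<in> I \<Longrightarrow> 1 \<le> lev (b i) \<and> lev (b i) < xlev (b i) \<and> xlev (b i) \<le> n"
    and iff: "\<And>k p. k < n \<Longrightarrow> lin I b p \<in> L k \<longleftrightarrow> (\<forall>i\<in>I. polX ^ pexpn (lev (b i)) (xlev (b i)) k dvd p i)"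
  define l where "l = (\<lambda>(i, j). card {s \<in> I. lev (b s) = i \<and> xlev (b s) = j})"
  have l0: "l p = 0" if "p \<notin> pair_index n" for p
  proof -
    obtain i j where p: "p = (i, j)" by (cases p)
    have "{s \<in> I. lev (b s) = i \<and> xlev (b s) = j} = {}"
      using rng that p by (auto simp: pair_index_def)
    then show ?thesis unfolding l_def p by (metis card.empty case_prod_conv)
  qed
  have J: "dsum_index n l = {(i, j, t). t < card {s \<in> I. lev (b s) = i \<and> xlev (b s) = j}}"
  proof -
    have "(i, j) \<in> pair_index n \<and> t < l (i, j) \<longleftrightarrow> t < l (i, j)" for i j t
      using l0[of "(i, j)"] by fastforce
    then show ?thesis unfolding dsum_index_def by (simp add: l_def)
  qed
  obtain h where h: "bij_betw h (dsum_index n l) I"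
    and hlev: "\<And>i j t. (i, j, t) \<in> dsum_index n l \<Longrightarrow> lev (b (h (i, j, t))) = i \<and> xlev (b (h (i, j, t))) = j"
    using fibre_enumeration[OF fin, of "\<lambda>s. lev (b s)" "\<lambda>s. xlev (b s)"] unfolding J by auto
  have lin1: "lin (dsum_index n l) (b \<circ> h) (p \<circ> h) = lin I b p" for p
    unfolding lin_def comp_def by (rule sum.reindex_bij_betw[OF h])
  define h' where "h' = the_inv_into (dsum_index n l) h"
  have h'h: "h' (h s) = s" if "s \<in> dsum_index n l" for s
    unfolding h'_def by (rule the_inv_into_f_f[OF bij_betw_imp_inj_on[OF h] that])
  have hI: "h s \<in> I" if "s \<in> dsum_index n l" for s using bij_betwE[OF h] that by blast
  have I_h: "I = h ` dsum_index n l" using bij_betw_imp_surj_on[OF h] by simp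
  have lin2: "lin (dsum_index n l) (b \<circ> h) p = lin I b (p \<circ> h')" for p
    unfolding lin1[symmetric] by (rule lin_cong) (simp add: h'h)
  show thesis
  proof (rule that[OF l0])
    have "range (lin (dsum_index n l) (b \<circ> h)) = range (lin I b)"
      using lin1 lin2 by (metis (no_types, lifting) image_subsetI rangeI subset_antisym)
    then show "range (lin (dsum_index n l) (b \<circ> h)) = L 0" by (simp only: gen)
    show "lin_independent (dsum_index n l) (b \<circ> h)"
      using ind unfolding lin_independent_def lin2 I_h by (auto simp: h'h)
    fix k :: nat and p :: "nat \<times> nat \<times> nat \<Rightarrow> 'k poly" assume k: "k < n"
    have "(\<forall>i\<in>I. polX ^ pexpn (lev (b i)) (xlev (b i)) k dvd (p \<circ> h') i) \<longleftrightarrow>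
      (\<forall>(i, j, t)\<in>dsum_index n l. polX ^ pexpn i j k dvd p (i, j, t))"
      unfolding I_h using hlev by (auto simp: h'h)
    then show "lin (dsum_index n l) (b \<circ> h) p \<in> L k \<longleftrightarrow>
      (\<forall>(i, j, t)\<in>dsum_index n l. polX ^ pexpn i j k dvd p (i, j, t))"
      unfolding lin2 iff[OF k] .
  qed
qed

section \<open>Coordinates of Lambda-lattices\<close>

lemma xvar_ne_0 [simp]: "(xvar :: 'k::field Kx) \<noteq> 0"
  by (simp add: xvar_def)

lemma xvar_power: "xvar ^ m = to_fract (polX ^ m)"
  by (induction m) (simp_all only: xvar_def power_0 power_Suc to_fract_1 to_fract_mult)

lemma in_xR_0 [simp]: "in_xR c 0"
  unfolding in_xR_def by (rule exI[of _ 0]) simp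

lemma in_xR_mono:
  fixes a :: "'k::field Kx"
  assumes "in_xR c a" "d \<le> c" shows "in_xR d a"
proof -
  obtain p where p: "a = xvar powi c * to_fract p" using assms(1) by (auto simp: in_xR_def)
  have "(xvar :: 'k Kx) powi c = xvar powi d * xvar powi (c - d)"
    by (simp flip: power_int_add)
  also have "(xvar :: 'k Kx) powi (c - d) = to_fract (polX ^ nat (c - d))"
    using assms(2) by (simp add: power_int_def flip: xvar_power)
  finally have "a = xvar powi d * to_fract (polX ^ nat (c - d) * p)"
    unfolding p by (simp add: mult.assoc)
  then show ?thesis unfolding in_xR_def by blast
qed

lemma in_xR_iff_dvd: "in_xR (int m) a \<longleftrightarrow> (\<exists>p. a = to_fract p \<and> polX ^ m dvd p)"
  unfolding in_xR_def power_int_of_nat xvar_power to_fract_mult[symmetric] by (blast elim: dvdE intro: dvd_triv_left)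

lemma in_xR_to_fract: "in_xR 0 (to_fract p)"
  unfolding in_xR_def by simp

text \<open>No exponent of the order is below -1 (\<open>cexp_ge\<close>), so one factor x clears
  the denominator of any entry.\<close>

lemma in_xR_minus_1:
  assumes "in_xR (- 1) a" obtains p where "xvar * a = to_fract p"
  using assms by (auto simp: in_xR_def power_int_minus mult.assoc[symmetric])

lemma pexp_eq_pexpn: "pexp i j (k + 1) = int (pexpn i j k)"
  by (simp add: pexp_def pexpn_def Suc_le_eq)

lemma cexp_ge: "- 1 \<le> cexp n i j" and cexp_le: "cexp n i j \<le> 2"
  by (simp_all add: cexp_def)

text \<open>The first row carries the weakest conditions, so an entry of any row may be moved to the
  first row of its column without leaving the order.\<close>

lemma cexp_first_row_le: "cexp n (Suc 0) j \<le> cexp n (Suc i) j"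
  by (auto simp: cexp_def)

section \<open>Scaled matrix units and scalar matrices\<close>

definition emat :: "nat \<Rightarrow> nat \<Rightarrow> nat \<Rightarrow> 'a::zero \<Rightarrow> 'a mat" where
  "emat n i j a = mat n n (\<lambda>(p, q). if p = i \<and> q = j then a else 0)"

lemma emat_carrier [simp]: "emat n i j a \<in> carrier_mat n n"
  by (simp add: emat_def)

lemma emat_mult:
  fixes a b :: "'a::semiring_0"
  assumes "i < n" "j < n" "k < n"
  shows "emat n i j a * emat n j k b = emat n i k (a * b)"
  using assms
  by (intro eq_matI) (auto simp: emat_def scalar_prod_def if_distrib[of "\<lambda>a. a * _"] if_distrib[of "\<lambda>a. _ * a"] cong: if_cong)

lemma emat_mult_0:
  fixes a b :: "'a::semiring_0"
  assumes "j \<noteq> k"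
  shows "emat n i j a * emat n k m b = 0\<^sub>m n n"
  using assms
  by (intro eq_matI) (auto simp: emat_def scalar_prod_def intro!: sum.neutral)

lemma emat_mult_mat:
  fixes A :: "'a::semiring_1 mat"
  assumes "i < n" "k < n" "A \<in> carrier_mat n n"
  shows "emat n i k 1 * A = mat n n (\<lambda>(p, q). if p = i then A $$ (k, q) else 0)"
  using assms
  by (intro eq_matI) (auto simp: emat_def scalar_prod_def if_distrib[of "\<lambda>a. a * _"] cong: if_cong)

lemma emat_mult_vec:
  fixes a :: "'a::semiring_0"
  assumes "j < n" "v \<in> carrier_vec n"
  shows "emat n i j a *\<^sub>v v = vec n (\<lambda>p. if p = i then a * v $ j else 0)"
  using assms
  by (intro eq_vecI) (auto simp: emat_def scalar_prod_def if_distrib[of "\<lambda>a. a * _"] cong: if_cong)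

lemma smult_emat: "r \<cdot>\<^sub>m emat n i j a = emat n i j (r * a :: 'a::semiring_0)"
  by (intro eq_matI) (auto simp: emat_def)

lemma LambdaI:
  "A \<in> carrier_mat n n \<Longrightarrow> (\<And>i j. i < n \<Longrightarrow> j < n \<Longrightarrow> in_xR (cexp n (i + 1) (j + 1)) (A $$ (i, j))) \<Longrightarrow> A \<in> Lambda n"
  by (simp add: Lambda_def)

lemma Lambda_carrier: "A \<in> Lambda n \<Longrightarrow> A \<in> carrier_mat n n"
  by (simp add: Lambda_def)

lemma Lambda_entry: "A \<in> Lambda n \<Longrightarrow> i < n \<Longrightarrow> j < n \<Longrightarrow> in_xR (cexp n (i + 1) (j + 1)) (A $$ (i, j))"
  by (simp add: Lambda_def)

lemma emat_in_Lambda: "in_xR (cexp n (i + 1) (j + 1)) a \<Longrightarrow> emat n i j a \<in> Lambda n"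
  by (rule LambdaI) (auto simp: emat_def)

lemma emat_to_fract_in_Lambda: "cexp n (i + 1) (j + 1) \<le> int m \<Longrightarrow> polX ^ m dvd p \<Longrightarrow> emat n i j (to_fract p) \<in> Lambda n"
  by (rule emat_in_Lambda, rule in_xR_mono[of "int m"]) (auto simp: in_xR_iff_dvd)

lemma emat_row_in_Lambda [simp]:
  assumes "i \<le> j" shows "emat n i j (1 :: 'k::field Kx) \<in> Lambda n"
proof -
  have "cexp n (i + 1) (j + 1) \<le> int 0" using assms by (simp add: cexp_def)
  from emat_to_fract_in_Lambda[OF this, of 1] show ?thesis by simp
qed

lemma scalar_in_Lambda: "to_fract r \<cdot>\<^sub>m 1\<^sub>m n \<in> Lambda n"
  by (rule LambdaI) (auto simp: cexp_def intro: in_xR_mono[OF in_xR_to_fract])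

lemma zero_in_Lambda: "0\<^sub>m n n \<in> Lambda n"
  by (rule LambdaI) auto

lemma scalar_mult_mat:
  fixes A :: "'a::comm_ring_1 mat"
  assumes "A \<in> carrier_mat n n"
  shows "(r \<cdot>\<^sub>m 1\<^sub>m n) * A = r \<cdot>\<^sub>m A" "A * (r \<cdot>\<^sub>m 1\<^sub>m n) = r \<cdot>\<^sub>m A"
  using assms by (simp_all add: mult_smult_assoc_mat[of _ n n] mult_smult_distrib[of _ n n _ n])

lemma smult_one_mat: "1 \<cdot>\<^sub>m A = (A :: 'a::semiring_1 mat)"
  by (rule eq_matI) auto

text \<open>The module is a subspace \<open>C\<close> of an ambient R-module, which makes library
  facts on modules over a type available. Finite generation over the order appears in
  \<open>C_gen\<close> as a containment principle: an R-subspace containing all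
  \<open>act A g\<close> contains \<open>C\<close>.\<close>

locale Lambda_lattice = torsion_free_poly_module scale
  for scale :: "'k::field poly \<Rightarrow> 'v::ab_group_add \<Rightarrow> 'v" (infixr \<open>*s\<close> 75) +
  fixes n :: nat and C :: "'v set" and act :: "'k Kx mat \<Rightarrow> 'v \<Rightarrow> 'v" and G :: "'v set"
  assumes n: "3 \<le> n"
    and subspace_C: "subspace C"
    and act_closed: "A \<in> Lambda n \<Longrightarrow> v \<in> C \<Longrightarrow> act A v \<in> C"
    and act_add: "A \<in> Lambda n \<Longrightarrow> u \<in> C \<Longrightarrow> v \<in> C \<Longrightarrow> act A (u + v) = act A u + act A v"
    and act_add_mat: "A \<in> Lambda n \<Longrightarrow> B \<in> Lambda n \<Longrightarrow> v \<in> C \<Longrightarrow> act (A + B) v = act A v + act B v"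
    and act_mult: "A \<in> Lambda n \<Longrightarrow> B \<in> Lambda n \<Longrightarrow> v \<in> C \<Longrightarrow> act (A * B) v = act A (act B v)"
    and act_scalar: "v \<in> C \<Longrightarrow> act (to_fract r \<cdot>\<^sub>m 1\<^sub>m n) v = r *s v"
    and finite_G: "finite G" and G_C: "G \<subseteq> C"
    and C_gen: "subspace S \<Longrightarrow> (\<And>A g. A \<in> Lambda n \<Longrightarrow> g \<in> G \<Longrightarrow> act A g \<in> S) \<Longrightarrow> C \<subseteq> S"
begin

lemma act_smult: "A \<in> Lambda n \<Longrightarrow> v \<in> C \<Longrightarrow> act (to_fract r \<cdot>\<^sub>m A) v = r *s act A v"
  using act_mult[OF scalar_in_Lambda, of A v r] act_scalar[OF act_closed, of A v r]
  by (simp add: scalar_mult_mat[OF Lambda_carrier])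

lemma act_scale: "A \<in> Lambda n \<Longrightarrow> v \<in> C \<Longrightarrow> act A (r *s v) = r *s act A v"
  using act_mult[OF _ scalar_in_Lambda, of A v r] act_scalar[of v r] act_smult[of A v r]
  by (simp add: scalar_mult_mat[OF Lambda_carrier])

lemma act_one: "v \<in> C \<Longrightarrow> act (1\<^sub>m n) v = v"
  using act_scalar[of v 1] by (simp add: smult_one_mat)

lemma act_zero_mat: "v \<in> C \<Longrightarrow> act (0\<^sub>m n n) v = 0"
  using act_add_mat[OF zero_in_Lambda zero_in_Lambda, of v] by simp

lemma act_zero: "A \<in> Lambda n \<Longrightarrow> act A 0 = 0"
  using act_add[of A 0 0] subspace_0[OF subspace_C] by simp

lemma act_sum: "A \<in> Lambda n \<Longrightarrow> (\<And>s. s \<in> S \<Longrightarrow> f s \<in> C) \<Longrightarrow> act A (\<Sum>s\<in>S. f s) = (\<Sum>s\<in>S. act A (f s))"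
  by (induction S rule: infinite_finite_induct)
    (simp_all add: act_zero act_add subspace_sum[OF subspace_C])

lemma act_diff: "A \<in> Lambda n \<Longrightarrow> u \<in> C \<Longrightarrow> v \<in> C \<Longrightarrow> act A (u - v) = act A u - act A v"
  using act_add[of A "u - v" v] subspace_diff[OF subspace_C, of u v] by simp

lemma act_emat_mult:
  assumes "i < n" "j < n" "k < n" "emat n i j a \<in> Lambda n" "emat n j k b \<in> Lambda n" "v \<in> C"
  shows "act (emat n i j a) (act (emat n j k b) v) = act (emat n i k (a * b)) v"
  using act_mult[OF assms(4-6)] assms(1-3) by (simp add: emat_mult)

lemma act_emat_scale: "emat n i j a \<in> Lambda n \<Longrightarrow> v \<in> C \<Longrightarrow> act (emat n i j (to_fract r * a)) v = r *s act (emat n i j a) v"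
  using act_smult[of "emat n i j a" v r] by (simp add: smult_emat)

text \<open>This is the matrix identity that \<open>E_0k A\<close> is the sum of the
  \<open>A_kj E_0j\<close>. Additivity of \<open>act\<close> is available only inside the order, so
  the row is built up from partial rows \<open>P r\<close>, which stay in it by
  \<open>cexp_first_row_le\<close>.\<close>

lemma act_row_expand:
  assumes A: "A \<in> Lambda n" and k: "k < n" and v: "v \<in> C"
  shows "act (emat n 0 k 1) (act A v) = (\<Sum>j<n. act (emat n 0 j (A $$ (k, j))) v)"
proof -
  define P where "P r = mat n n (\<lambda>(p, q). if p = 0 \<and> q < r then A $$ (k, q) else 0)" for r
  have entry: "in_xR (cexp n (Suc 0) (Suc j)) (A $$ (k, j))" if "j < n" for j
    using Lambda_entry[OF A k that] by (rule in_xR_mono) (simp add: cexp_first_row_le)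
  have P: "P r \<in> Lambda n" for r
    by (rule LambdaI) (use entry in \<open>auto simp: P_def\<close>)
  have "act (P r) v = (\<Sum>j<r. act (emat n 0 j (A $$ (k, j))) v)" if "r \<le> n" for r
    using that
  proof (induction r)
    case 0
    have "P 0 = 0\<^sub>m n n" by (rule eq_matI) (auto simp: P_def)
    then show ?case using act_zero_mat[OF v] by simp
  next
    case (Suc r)
    have "P (Suc r) = P r + emat n 0 r (A $$ (k, r))"
      by (rule eq_matI) (auto simp: P_def emat_def)
    moreover have "emat n 0 r (A $$ (k, r)) \<in> Lambda n"
      using entry Suc.prems by (intro emat_in_Lambda) simp
    ultimately show ?case using Suc act_add_mat[OF P _ v, of "emat n 0 r (A $$ (k, r))" r] by simp
  qed
  moreover have "P n = emat n 0 k 1 * A"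
    using emat_mult_mat[of 0 n k A] k Lambda_carrier[OF A] by (auto simp: P_def intro!: eq_matI)
  moreover have "act (emat n 0 k 1 * A) v = act (emat n 0 k 1) (act A v)"
    by (rule act_mult) (simp_all add: A v)
  ultimately show ?thesis by (metis order_refl)
qed

lemma act_diag_expand:
  assumes v: "v \<in> C"
  shows "v = (\<Sum>k<n. act (emat n k k 1) v)"
proof -
  define P where "P r = mat n n (\<lambda>(p, q). if p = q \<and> p < r then 1 else 0 :: 'k Kx)" for r
  have P: "P r \<in> Lambda n" for r
    by (rule LambdaI) (use n in \<open>auto simp: P_def cexp_def intro: in_xR_to_fract[of 1, simplified]\<close>)
  have "act (P r) v = (\<Sum>k<r. act (emat n k k 1) v)" if "r \<le> n" for r
    using that
  proof (induction r)
    case 0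
    have "P 0 = 0\<^sub>m n n" by (rule eq_matI) (auto simp: P_def)
    then show ?case using act_zero_mat[OF v] by simp
  next
    case (Suc r)
    have "P (Suc r) = P r + emat n r r 1"
      by (rule eq_matI) (auto simp: P_def emat_def)
    then show ?case using Suc act_add_mat[OF P _ v, of "emat n r r 1" r] by simp
  qed
  moreover have "P n = 1\<^sub>m n" by (rule eq_matI) (auto simp: P_def)
  ultimately show ?thesis using act_one[OF v] by (metis order_refl)
qed

definition L :: "nat \<Rightarrow> 'v set" where "L k = act (emat n 0 k 1) ` C"

lemma subspace_L: "subspace (L k)"
proof (rule subspaceI)
  show "0 \<in> L k" unfolding L_def
    by (rule image_eqI[of _ _ 0]) (simp_all add: act_zero subspace_0[OF subspace_C])
  show "u + v \<in> L k" if "u \<in> L k" "v \<in> L k" for u v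
    using that act_add[of "emat n 0 k 1"] subspace_add[OF subspace_C] unfolding L_def by (force simp: image_iff)
  show "c *s u \<in> L k" if "u \<in> L k" for c u
    using that subspace_scale[OF subspace_C] unfolding L_def by (auto simp flip: act_scale)
qed

lemma L_0_I: "v \<in> C \<Longrightarrow> j < n \<Longrightarrow> emat n 0 j a \<in> Lambda n \<Longrightarrow> act (emat n 0 j a) v \<in> L 0"
  unfolding L_def using n by (intro image_eqI[of _ _ "act (emat n 0 j a) v"]) (simp_all add: act_emat_mult act_closed)

text \<open>The matrices used generate the first row of the order over R. Applied to the generators
  of \<open>C\<close> they give finitely many R-generators of \<open>L 0\<close>, as required for a
  basis.\<close>

definition Xg :: "'v set" where
  "Xg = (\<lambda>(j, g). act (emat n 0 j (xvar powi cexp n (Suc 0) (Suc j))) g) ` ({..<n} \<times> G)"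

lemma emat_first_row_in_Lambda: "emat n 0 j (xvar powi cexp n (Suc 0) (Suc j)) \<in> Lambda n"
  by (rule emat_in_Lambda) (auto simp: in_xR_def intro!: exI[of _ 1])

lemma span_Xg: "L 0 = span Xg"
proof
  have "Xg \<subseteq> L 0"
    unfolding Xg_def using G_C by (auto intro!: L_0_I emat_first_row_in_Lambda)
  then show "span Xg \<subseteq> L 0" by (rule span_minimal[OF _ subspace_L])
next
  define S where "S = {v \<in> C. act (emat n 0 0 1) v \<in> span Xg}"
  have "subspace S"
    unfolding S_def
    by (rule subspaceI)
      (auto simp: act_zero act_add act_scale span_zero span_add span_scale
        subspace_0[OF subspace_C] subspace_add[OF subspace_C] subspace_scale[OF subspace_C])
  moreover have "act A g \<in> S" if A: "A \<in> Lambda n" and g: "g \<in> G" for A g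
  proof -
    have gC: "g \<in> C" using g G_C by blast
    have "act (emat n 0 j (A $$ (0, j))) g \<in> span Xg" if j: "j < n" for j
    proof -
      obtain p where p: "A $$ (0, j) = to_fract p * xvar powi cexp n (Suc 0) (Suc j)"
        using Lambda_entry[OF A _ j, of 0] n by (auto simp: in_xR_def mult.commute)
      show ?thesis unfolding p act_emat_scale[OF emat_first_row_in_Lambda gC]
        by (intro span_scale span_base) (use j g in \<open>auto simp: Xg_def\<close>)
    qed
    then show ?thesis unfolding S_def
      using act_row_expand[OF A _ gC, of 0] n act_closed[OF A gC] by (auto intro!: span_sum)
  qed
  ultimately have "C \<subseteq> S" by (rule C_gen)
  then show "L 0 \<subseteq> span Xg" unfolding L_def S_def by auto
qed

lemma emat_xpow: "polX ^ m *s act (emat n i j 1) v = act (emat n i j (to_fract (polX ^ m))) v" 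
  if "i \<le> j" "v \<in> C" for i j m v
  using act_emat_scale[of i j 1 v "polX ^ m"] that by simp

text \<open>Each relation comes from one element of the order, with zero-based indices:
  \<open>E_{k,k+1}\<close> for the inclusions, \<open>x E_{k+1,k}\<close> for the shift,
  \<open>x^(-1) E_{0,n-1}\<close> for the last lattice, and \<open>x^2 E_{n-1,0}\<close> for the
  bound below.\<close>

lemma lattice_chain_L: "lattice_chain scale L n Xg"
proof unfold_locales
  show "2 \<le> n" using n by simp
  show "subspace (L k)" for k by (rule subspace_L)
  show "finite Xg" unfolding Xg_def using finite_G by simp
  show "L 0 = span Xg" by (rule span_Xg)
  show "L (Suc k) \<subseteq> L k" if k: "Suc k < n" for k
  proof
    fix u assume "u \<in> L (Suc k)"
    then obtain v where v: "v \<in> C" "u = act (emat n 0 (Suc k) 1) v" by (auto simp: L_def)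
    then have "u = act (emat n 0 k 1) (act (emat n k (Suc k) 1) v)"
      using k n by (simp add: act_emat_mult)
    then show "u \<in> L k" unfolding L_def using v act_closed[of "emat n k (Suc k) 1" v] by simp
  qed
  show "polX *s u \<in> L (Suc k)" if k: "Suc k < n" and u: "u \<in> L k" for k u
  proof -
    obtain v where v: "v \<in> C" "u = act (emat n 0 k 1) v" using u by (auto simp: L_def)
    have E: "emat n (Suc k) k (to_fract polX :: 'k Kx) \<in> Lambda n"
      by (rule emat_to_fract_in_Lambda[of _ _ _ 1]) (simp_all add: cexp_def)
    have "polX *s u = act (emat n 0 (Suc k) 1) (act (emat n (Suc k) k (to_fract polX)) v)"
      using emat_xpow[of 0 k v 1] v k E by (simp add: act_emat_mult)
    then show ?thesis unfolding L_def using v(1) act_closed[OF E] by simp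
  qed
  show "\<exists>w\<in>L 0. v = polX *s w" if v: "v \<in> L (n - 1)" for v
  proof -
    obtain u where u: "u \<in> C" "v = act (emat n 0 (n - 1) 1) u" using v by (auto simp: L_def)
    have E: "emat n 0 (n - 1) (xvar powi - 1) \<in> Lambda n"
      using emat_first_row_in_Lambda[of "n - 1"] n by (simp add: cexp_def)
    have "to_fract polX * (xvar :: 'k Kx) powi - 1 = 1"
      by (simp add: xvar_def[symmetric] power_int_minus)
    then have "v = polX *s act (emat n 0 (n - 1) (xvar powi - 1)) u"
      using act_emat_scale[OF E u(1), of polX] u(2) by simp
    then show ?thesis using L_0_I[OF u(1) _ E] n by auto
  qed
  show "polX\<^sup>2 *s v \<in> L (n - 1)" if v: "v \<in> L 0" for v
  proof -
    obtain u where u: "u \<in> C" "v = act (emat n 0 0 1) u" using v by (auto simp: L_def)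
    have E: "emat n (n - 1) 0 (to_fract (polX\<^sup>2) :: 'k Kx) \<in> Lambda n"
      by (rule emat_to_fract_in_Lambda[of _ _ _ 2]) (use cexp_le in simp_all)
    have "polX\<^sup>2 *s v = act (emat n 0 (n - 1) 1) (act (emat n (n - 1) 0 (to_fract (polX\<^sup>2))) u)"
      using emat_xpow[of 0 0 u 2] u n E by (simp add: act_emat_mult)
    then show ?thesis unfolding L_def using u(1) act_closed[OF E] by simp
  qed
qed

text \<open>The product of \<open>x^2 E_k0\<close> and \<open>E_0k\<close> is
  \<open>x^2 E_kk\<close>, and torsion-freeness cancels \<open>x^2\<close>. Hence all diagonal
  components of \<open>v\<close> vanish.\<close>

lemma eq_0_if_rows_0:
  assumes v: "v \<in> C" and rows: "\<And>k. k < n \<Longrightarrow> act (emat n 0 k 1) v = 0"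
  shows "v = 0"
proof -
  have "act (emat n k k 1) v = 0" if k: "k < n" for k
  proof -
    have E: "emat n k 0 (to_fract (polX\<^sup>2) :: 'k Kx) \<in> Lambda n"
      by (rule emat_to_fract_in_Lambda[of _ _ _ 2]) (use cexp_le in simp_all)
    have "polX\<^sup>2 *s act (emat n k k 1) v = act (emat n k 0 (to_fract (polX\<^sup>2))) (act (emat n 0 k 1) v)"
      using emat_xpow[of k k v 2] v k n E by (simp add: act_emat_mult)
    also have "\<dots> = 0" using rows[OF k] act_zero[OF E] by simp
    finally show ?thesis using torsion_free by fastforce
  qed
  then show ?thesis using act_diag_expand[OF v] by simp
qed

text \<open>The idempotents \<open>E_jj\<close> separate the rows, so the rows can be prescribed
  independently. Together with \<open>eq_0_if_rows_0\<close> this identifies \<open>C\<close> with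
  the product of the lattices \<open>L k\<close>.\<close>

lemma rows_realize:
  assumes u: "\<And>k. k < n \<Longrightarrow> u k \<in> L k"
  obtains v where "v \<in> C" "\<And>k. k < n \<Longrightarrow> act (emat n 0 k 1) v = u k"
proof -
  obtain w where w: "\<And>k. k < n \<Longrightarrow> w k \<in> C \<and> u k = act (emat n 0 k 1) (w k)"
    using u unfolding L_def image_iff by metis
  define v where "v = (\<Sum>j<n. act (emat n j j 1) (w j))"
  show thesis
  proof
    show "v \<in> C" unfolding v_def using w by (intro subspace_sum[OF subspace_C] act_closed) auto
    fix k assume k: "k < n"
    have "act (emat n 0 k 1) v = (\<Sum>j<n. act (emat n 0 k 1) (act (emat n j j 1) (w j)))"
      unfolding v_def using w by (intro act_sum) (auto intro: act_closed)
    also have "\<dots> = (\<Sum>j<n. if j = k then u k else 0)"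
    proof (rule sum.cong)
      fix j assume j: "j \<in> {..<n}"
      show "act (emat n 0 k 1) (act (emat n j j 1) (w j)) = (if j = k then u k else 0)"
      proof (cases "j = k")
        case True then show ?thesis using k w n by (simp add: act_emat_mult)
      next
        case False
        then have "act (emat n 0 k 1) (act (emat n j j 1) (w j)) = act (emat n 0 k 1 * emat n j j 1) (w j)"
          using w j by (simp add: act_mult)
        then show ?thesis using False w j by (simp add: emat_mult_0 act_zero_mat)
      qed
    qed simp
    finally show "act (emat n 0 k 1) v = u k" using k by simp
  qed
qed

text \<open>Entry \<open>k\<close> of component \<open>s\<close> of the image is the coordinate at
  \<open>b s\<close> of the row \<open>E_0k v\<close>. Adaptedness says that these coordinates
  satisfy exactly the divisibility conditions defining \<open>pair_set\<close>.\<close>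

lemma isomorphism_to_dsum:
  obtains l \<Phi> where "\<And>p. p \<notin> pair_index n \<Longrightarrow> l p = 0"
    "bij_betw \<Phi> C (lcarrier (dsum_module n l :: (_, nat \<times> nat \<times> nat \<Rightarrow> 'k Kx vec) lmod))"
    "\<And>u v. u \<in> C \<Longrightarrow> v \<in> C \<Longrightarrow> \<Phi> (u + v) = (\<lambda>p. \<Phi> u p + \<Phi> v p)"
    "\<And>A v. A \<in> Lambda n \<Longrightarrow> v \<in> C \<Longrightarrow> \<Phi> (act A v) = (\<lambda>p. A *\<^sub>v \<Phi> v p)"
proof (rule lattice_chain.adapted_indexed_basis[OF lattice_chain_L])
  fix l b
  assume l0: "\<And>p. p \<notin> pair_index n \<Longrightarrow> l p = 0"
    and gen: "range (lin (dsum_index n l) b) = L 0" and ind: "lin_independent (dsum_index n l) b"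
    and iff: "\<And>k p. k < n \<Longrightarrow> lin (dsum_index n l) b p \<in> L k \<longleftrightarrow>
      (\<forall>(i, j, t)\<in>dsum_index n l. polX ^ pexpn i j k dvd p (i, j, t))"
  define J where "J = dsum_index n l"
  define co where "co u = (SOME p. lin J b p = u)" for u
  define row where "row k v = act (emat n 0 k 1) v" for k v
  have lin_co: "lin J b (co u) = u" if "u \<in> L 0" for u
    unfolding co_def
    proof (rule someI_ex[where P = "\<lambda>p. lin J b p = u"])
    have "u \<in> range (lin J b)" using gen that by (simp add: J_def)
    then show "\<exists>p. lin J b p = u" by blast
  qed
  have co_unique: "co u s = p s" if u: "u = lin J b p" and s: "s \<in> J" for u p s
  proof -
    have "u \<in> L 0" using gen u by (auto simp: J_def)
    then have "lin J b (\<lambda>i. co u i - p i) = 0" using lin_co u by (simp add: lin_diff)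
    then have "\<forall>i\<in>J. co u i - p i = 0" using ind[folded J_def, unfolded lin_independent_def, THEN spec] by blast
    then show ?thesis using s by simp
  qed
  have L_row: "row k v \<in> L k" if "v \<in> C" for k v using that by (simp add: L_def row_def)
  have row_0: "row k v \<in> L 0" if "v \<in> C" "k < n" for k v
    using L_0_I[OF that, of 1] by (simp add: row_def)
  define \<Phi> where "\<Phi> v s = (if s \<in> J then vec n (\<lambda>k. to_fract (co (row k v) s)) else 0\<^sub>v n)" for v s
  have J_iff: "(i, j, t) \<in> J \<longleftrightarrow> (i, j) \<in> pair_index n \<and> t < l (i, j)" for i j t
    by (simp add: J_def dsum_index_def)
  have carrier: "lcarrier (dsum_module n l) =
      {f. \<forall>i j t. if (i, j, t) \<in> J then f (i, j, t) \<in> pair_set n i j else f (i, j, t) = 0\<^sub>v n}"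
    by (simp add: dsum_module_def J_iff)
  show thesis
  proof (rule that[OF l0])
    show "\<Phi> (u + v) = (\<lambda>s. \<Phi> u s + \<Phi> v s)" if uv: "u \<in> C" "v \<in> C" for u v
    proof
      fix s
      have "co (row k (u + v)) s = co (row k u) s + co (row k v) s" if "k < n" "s \<in> J" for k
      proof (rule co_unique[OF _ that(2)])
        show "row k (u + v) = lin J b (\<lambda>s. co (row k u) s + co (row k v) s)"
          using uv that row_0 by (simp add: lin_add lin_co) (simp add: row_def act_add)
      qed
      then show "\<Phi> (u + v) s = \<Phi> u s + \<Phi> v s"
        unfolding \<Phi>_def by (auto intro!: eq_vecI)
    qed
    show "\<Phi> (act A v) = (\<lambda>s. A *\<^sub>v \<Phi> v s)" if A: "A \<in> Lambda n" and v: "v \<in> C" for A v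
    proof
      fix s
      have "to_fract (co (row k (act A v)) s) = (\<Sum>j<n. A $$ (k, j) * to_fract (co (row j v) s))"
        if k: "k < n" and s: "s \<in> J" for k
      proof -
        \<comment> \<open>Coordinates are compared after multiplication by x, since the entry of the
          order with exponent -1 need not be a polynomial; the factor is cancelled at the
          end.\<close>
        have "\<exists>p. xvar * A $$ (k, j) = to_fract p" if "j < n" for j
          using in_xR_minus_1[OF in_xR_mono[OF Lambda_entry[OF A k that] cexp_ge]] by blast
        then obtain p where p: "\<And>j. j < n \<Longrightarrow> xvar * A $$ (k, j) = to_fract (p j)" by metis
        have entry: "emat n 0 j (A $$ (k, j)) \<in> Lambda n" if "j < n" for j
          by (rule emat_in_Lambda, rule in_xR_mono[OF Lambda_entry[OF A k that]]) (simp add: cexp_first_row_le)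
        have "polX *s row k (act A v) = (\<Sum>j<n. polX *s act (emat n 0 j (A $$ (k, j))) v)"
          unfolding row_def act_row_expand[OF A k v] scale_sum_right ..
        also have "\<dots> = (\<Sum>j<n. p j *s row j v)"
        proof (rule sum.cong[OF refl])
          fix j assume "j \<in> {..<n}"
          then have j: "j < n" by simp
          have "polX *s act (emat n 0 j (A $$ (k, j))) v = act (emat n 0 j (to_fract (p j))) v"
            using act_emat_scale[OF entry[OF j] v, of polX] p[OF j] by (simp add: xvar_def)
          also have "\<dots> = p j *s row j v"
            using act_emat_scale[of 0 j 1 v "p j"] v by (simp add: row_def)
          finally show "polX *s act (emat n 0 j (A $$ (k, j))) v = p j *s row j v" .
        qed
        finally have "polX *s row k (act A v) = (\<Sum>j<n. p j *s lin J b (co (row j v)))"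
          using row_0 v by (simp add: lin_co)
        also have "\<dots> = lin J b (\<lambda>s. \<Sum>j<n. p j * co (row j v) s)"
          unfolding lin_def scale_sum_right scale_sum_left scale_scale by (rule sum.swap)
        finally have e1: "co (polX *s row k (act A v)) s = (\<Sum>j<n. p j * co (row j v) s)"
          by (rule co_unique[OF _ s])
        have "co (polX *s row k (act A v)) s = polX * co (row k (act A v)) s"
          by (rule co_unique[OF _ s, of _ "\<lambda>s. polX * co (row k (act A v)) s"])
            (simp only: lin_scale lin_co row_0[OF act_closed[OF A v] k])
        with e1 have "polX * co (row k (act A v)) s = (\<Sum>j<n. p j * co (row j v) s)" by simp
        then have "to_fract (polX * co (row k (act A v)) s) = to_fract (\<Sum>j<n. p j * co (row j v) s)"
          by (rule arg_cong)
        then have "xvar * to_fract (co (row k (act A v)) s) = (\<Sum>j<n. to_fract (p j) * to_fract (co (row j v) s))"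
          by (simp only: to_fract_mult to_fract_sum xvar_def)
        also have "\<dots> = xvar * (\<Sum>j<n. A $$ (k, j) * to_fract (co (row j v) s))"
          unfolding sum_distrib_left by (rule sum.cong) (simp_all add: p[symmetric] mult.assoc)
        finally show ?thesis by (simp only: mult_cancel_left xvar_ne_0 simp_thms)
      qed
      then show "\<Phi> (act A v) s = A *\<^sub>v \<Phi> v s"
        unfolding \<Phi>_def using Lambda_carrier[OF A]
        by (auto intro!: eq_vecI simp: scalar_prod_def atLeast0LessThan)
    qed
    show "bij_betw \<Phi> C (lcarrier (dsum_module n l :: (_, nat \<times> nat \<times> nat \<Rightarrow> 'k Kx vec) lmod))"
      unfolding carrier
    proof (rule bij_betw_imageI)
      show "inj_on \<Phi> C"
      proof (rule inj_onI)
        fix u v assume uv: "u \<in> C" "v \<in> C" "\<Phi> u = \<Phi> v"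
        have "row k (u - v) = 0" if k: "k < n" for k
        proof -
          have "co (row k u) s = co (row k v) s" if s: "s \<in> J" for s
          proof -
            have "\<Phi> u s $ k = \<Phi> v s $ k" using uv(3) by simp
            then show ?thesis using s k by (simp add: \<Phi>_def)
          qed
          then have "lin J b (co (row k u)) = lin J b (co (row k v))" by (rule lin_cong)
          then have "row k u = row k v" using lin_co row_0 uv k by simp
          then show ?thesis using uv by (simp add: row_def act_diff)
        qed
        then have "u - v = 0" unfolding row_def
          by (rule eq_0_if_rows_0[OF subspace_diff[OF subspace_C uv(1,2)]])
        then show "u = v" by simp
      qed
      show "\<Phi> ` C = {f. \<forall>i j t. if (i, j, t) \<in> J then f (i, j, t) \<in> pair_set n i j else f (i, j, t) = 0\<^sub>v n}"
      proof (intro subset_antisym subsetI)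
        fix f assume "f \<in> \<Phi> ` C"
        then obtain v where v: "v \<in> C" "f = \<Phi> v" by blast
        have "to_fract (co (row k v) (i, j, t)) \<in> {a. in_xR (pexp i j (k + 1)) a}" if k: "k < n" and J: "(i, j, t) \<in> J" for i j t k
        proof -
          have "lin J b (co (row k v)) \<in> L k" using L_row row_0 lin_co v(1) k by simp
          then have "polX ^ pexpn i j k dvd co (row k v) (i, j, t)"
            using iff[OF k] J unfolding J_def by fastforce
          then show ?thesis by (auto simp only: pexp_eq_pexpn in_xR_iff_dvd)
        qed
        then show "f \<in> {f. \<forall>i j t. if (i, j, t) \<in> J then f (i, j, t) \<in> pair_set n i j else f (i, j, t) = 0\<^sub>v n}"
          by (auto simp: v(2) \<Phi>_def pair_set_def)
      next
        fix f :: "nat \<times> nat \<times> nat \<Rightarrow> 'k Kx vec"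
        assume "f \<in> {f. \<forall>i j t. if (i, j, t) \<in> J then f (i, j, t) \<in> pair_set n i j else f (i, j, t) = 0\<^sub>v n}"
        then have f1: "\<And>i j t. (i, j, t) \<in> J \<Longrightarrow> f (i, j, t) \<in> pair_set n i j"
          and f2: "\<And>i j t. (i, j, t) \<notin> J \<Longrightarrow> f (i, j, t) = 0\<^sub>v n" by (auto split: if_splits)
        \<comment> \<open>The numerators serve as coordinates of the rows of a preimage; adaptedness
          puts the \<open>k\<close>-th row into \<open>L k\<close>, so \<open>rows_realize\<close>
          applies.\<close>
        have "\<forall>k s. k < n \<and> s \<in> J \<longrightarrow> (\<exists>p. f s $ k = to_fract p \<and> polX ^ pexpn (fst s) (fst (snd s)) k dvd p)"
        proof (intro allI impI)
          fix k s assume ks: "k < n \<and> s \<in> J"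
          then have "f s \<in> pair_set n (fst s) (fst (snd s))" using f1[of "fst s" "fst (snd s)" "snd (snd s)"] by simp
          then have "in_xR (pexp (fst s) (fst (snd s)) (k + 1)) (f s $ k)" using ks by (simp add: pair_set_def)
          then show "\<exists>p. f s $ k = to_fract p \<and> polX ^ pexpn (fst s) (fst (snd s)) k dvd p"
            unfolding pexp_eq_pexpn in_xR_iff_dvd .
        qed
        then obtain p where p: "\<And>k s. k < n \<Longrightarrow> s \<in> J \<Longrightarrow> f s $ k = to_fract (p k s) \<and> polX ^ pexpn (fst s) (fst (snd s)) k dvd p k s"
          by metis
        have "lin J b (p k) \<in> L k" if k: "k < n" for k
          unfolding J_def iff[OF k]
        proof clarify
          fix i j t assume "(i, j, t) \<in> dsum_index n l"
          then show "polX ^ pexpn i j k dvd p k (i, j, t)" using p[OF k, of "(i, j, t)"] by (simp add: J_def)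
        qed
        then obtain v where v: "v \<in> C" "\<And>k. k < n \<Longrightarrow> row k v = lin J b (p k)"
          unfolding row_def using rows_realize[of "\<lambda>k. lin J b (p k)"] by blast
        have "\<Phi> v s = f s" for s
        proof (cases "s \<in> J")
          case True
          then have "dim_vec (f s) = n" using f1[of "fst s" "fst (snd s)" "snd (snd s)"] by (simp add: pair_set_def)
          then show ?thesis unfolding \<Phi>_def using True p[OF _ True] co_unique[OF v(2) True] by (auto intro!: eq_vecI)
        next
          case False
          then show ?thesis using f2[of "fst s" "fst (snd s)" "snd (snd s)"] by (simp add: \<Phi>_def)
        qed
        then have "f = \<Phi> v" by auto
        then show "f \<in> \<Phi> ` C" using v(1) by blast
      qed
    qed
  qed
qed

end

section \<open>Cohen-Macaulay modules as lattices\<close>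

locale Lambda_module =
  fixes n :: nat and M :: "('k::field Kx mat, 'm) lmod"
  assumes Lambda_module: "is_Lambda_module n M"
begin

lemma lzero_closed [simp]: "lzero M \<in> lcarrier M"
  using Lambda_module unfolding is_Lambda_module_def by (elim conjE) metis

lemma ladd_closed [simp]: "a \<in> lcarrier M \<Longrightarrow> b \<in> lcarrier M \<Longrightarrow> ladd M a b \<in> lcarrier M"
  using Lambda_module unfolding is_Lambda_module_def by (elim conjE) metis

lemma lact_closed [simp]: "A \<in> Lambda n \<Longrightarrow> a \<in> lcarrier M \<Longrightarrow> lact M A a \<in> lcarrier M"
  using Lambda_module unfolding is_Lambda_module_def by (elim conjE) metis

lemma ladd_assoc: "a \<in> lcarrier M \<Longrightarrow> b \<in> lcarrier M \<Longrightarrow> c \<in> lcarrier M \<Longrightarrow>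
    ladd M (ladd M a b) c = ladd M a (ladd M b c)"
  using Lambda_module unfolding is_Lambda_module_def by (elim conjE) metis

lemma ladd_commute: "a \<in> lcarrier M \<Longrightarrow> b \<in> lcarrier M \<Longrightarrow> ladd M a b = ladd M b a"
  using Lambda_module unfolding is_Lambda_module_def by (elim conjE) metis

lemma ladd_zero: "a \<in> lcarrier M \<Longrightarrow> ladd M (lzero M) a = a"
  using Lambda_module unfolding is_Lambda_module_def by (elim conjE) metis

lemma ladd_inverse: "a \<in> lcarrier M \<Longrightarrow> \<exists>b\<in>lcarrier M. ladd M a b = lzero M"
  using Lambda_module unfolding is_Lambda_module_def by (elim conjE) metis

lemma lact_add: "A \<in> Lambda n \<Longrightarrow> a \<in> lcarrier M \<Longrightarrow> b \<in> lcarrier M \<Longrightarrow>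
    lact M A (ladd M a b) = ladd M (lact M A a) (lact M A b)"
  using Lambda_module unfolding is_Lambda_module_def by (elim conjE) metis

lemma lact_add_mat: "A \<in> Lambda n \<Longrightarrow> B \<in> Lambda n \<Longrightarrow> a \<in> lcarrier M \<Longrightarrow>
    lact M (A + B) a = ladd M (lact M A a) (lact M B a)"
  using Lambda_module unfolding is_Lambda_module_def by (elim conjE) metis

lemma lact_mult: "A \<in> Lambda n \<Longrightarrow> B \<in> Lambda n \<Longrightarrow> a \<in> lcarrier M \<Longrightarrow>
    lact M (A * B) a = lact M A (lact M B a)"
  using Lambda_module unfolding is_Lambda_module_def by (elim conjE) metis

text \<open>The additive group is written multiplicatively, so that finite sums in \<open>M\<close>
  become \<open>finprod\<close>.\<close>

abbreviation addgrp :: "'m monoid" where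
  "addgrp \<equiv> \<lparr>carrier = lcarrier M, monoid.mult = ladd M, one = lzero M\<rparr>"

sublocale G: comm_group addgrp
  rewrites "carrier addgrp = lcarrier M" and "monoid.mult addgrp = ladd M" and "one addgrp = lzero M"
proof -
  show "comm_group addgrp"
  proof (rule comm_groupI)
    show "\<exists>y\<in>carrier addgrp. y \<otimes>\<^bsub>addgrp\<^esub> x = \<one>\<^bsub>addgrp\<^esub>" if "x \<in> carrier addgrp" for x
      using that ladd_inverse[of x] ladd_commute[of x] by auto
  qed (auto simp: ladd_assoc ladd_zero intro: ladd_commute)
qed simp_all

lemma ladd_self_eq: "a \<in> lcarrier M \<Longrightarrow> ladd M a a = a \<Longrightarrow> a = lzero M"
  using G.l_cancel_one[of a a] by simp

lemma ract_closed [simp]: "a \<in> lcarrier M \<Longrightarrow> ract n M r a \<in> lcarrier M"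
  unfolding ract_def by (simp add: scalar_in_Lambda)

lemma ract_add: "a \<in> lcarrier M \<Longrightarrow> b \<in> lcarrier M \<Longrightarrow> ract n M r (ladd M a b) = ladd M (ract n M r a) (ract n M r b)"
  unfolding ract_def by (simp add: scalar_in_Lambda lact_add)

lemma ract_add_left: "a \<in> lcarrier M \<Longrightarrow> ract n M (r + s) a = ladd M (ract n M r a) (ract n M s a)"
  unfolding ract_def by (simp add: scalar_in_Lambda flip: lact_add_mat add_smult_distrib_right_mat[of _ n n])

lemma ract_mult: "a \<in> lcarrier M \<Longrightarrow> ract n M (r * s) a = ract n M r (ract n M s a)"
proof -
  assume "a \<in> lcarrier M"
  moreover have "to_fract (r * s) \<cdot>\<^sub>m 1\<^sub>m n = (to_fract r \<cdot>\<^sub>m 1\<^sub>m n) * (to_fract s \<cdot>\<^sub>m 1\<^sub>m n :: 'k Kx mat)"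
    by (subst scalar_mult_mat(1)[of _ n]) (auto simp: mult.assoc)
  ultimately show ?thesis unfolding ract_def by (simp add: scalar_in_Lambda lact_mult)
qed

lemma ract_zero_left: "a \<in> lcarrier M \<Longrightarrow> ract n M 0 a = lzero M"
  using ract_add_left[of a 0 0] by (intro ladd_self_eq) auto

lemma ract_zero: "ract n M r (lzero M) = lzero M"
  using ract_add[of "lzero M" "lzero M" r] by (intro ladd_self_eq) (auto simp: ladd_zero)

lemma lcomb_eq_finprod:
  assumes "distinct bs" "set bs \<subseteq> lcarrier M"
  shows "lcomb M (ract n M) (map (\<lambda>b. (r b, b)) bs) = finprod addgrp (\<lambda>b. ract n M (r b) b) (set bs)"
  using assms
proof (induction bs)
  case Nil then show ?case by simp
next
  case (Cons b bs)
  then show ?case by (subst list.set(2), subst G.finprod_insert) auto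
qed

end

lemma zip_conv_map_map_of:
  assumes "distinct bs" "length rs = length bs"
  shows "zip rs bs = map (\<lambda>b. (the (map_of (zip bs rs) b), b)) bs"
  using assms by (intro nth_equalityI) (auto simp: map_of_zip_nth)

text \<open>Since the lists of basis elements are distinct, coefficient lists can be replaced by
  coefficient functions and ordered sums by sums over finite sets.\<close>

lemma R_free_finprod:
  assumes "R_free n M" "is_Lambda_module n M"
  obtains B where "B \<subseteq> lcarrier M"
    "\<And>m. m \<in> lcarrier M \<Longrightarrow> \<exists>F r. finite F \<and> F \<subseteq> B \<and>
      m = finprod \<lparr>carrier = lcarrier M, monoid.mult = ladd M, one = lzero M\<rparr> (\<lambda>b. ract n M (r b) b) F"
    "\<And>F r b. finite F \<Longrightarrow> F \<subseteq> B \<Longrightarrow>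
      finprod \<lparr>carrier = lcarrier M, monoid.mult = ladd M, one = lzero M\<rparr> (\<lambda>b. ract n M (r b) b) F = lzero M \<Longrightarrow>
      b \<in> F \<Longrightarrow> r b = 0"
proof -
  interpret Lambda_module n M by unfold_locales (rule assms(2))
  obtain B where B: "B \<subseteq> lcarrier M"
    and span: "\<And>m. m \<in> lcarrier M \<Longrightarrow> \<exists>bs rs. distinct bs \<and> set bs \<subseteq> B \<and> length rs = length bs \<and>
          m = lcomb M (ract n M) (zip rs bs)"
    and ind: "\<And>bs rs. distinct bs \<Longrightarrow> set bs \<subseteq> B \<Longrightarrow> length rs = length bs \<Longrightarrow>
          lcomb M (ract n M) (zip rs bs) = lzero M \<Longrightarrow> \<forall>r\<in>set rs. r = 0"
    using assms(1) unfolding R_free_def by metis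
  show thesis
  proof (rule that[OF B])
    fix m assume "m \<in> lcarrier M"
    then obtain bs rs where bs: "distinct bs" "set bs \<subseteq> B" "length rs = length bs"
      and m: "m = lcomb M (ract n M) (zip rs bs)" using span by blast
    define r where "r b = the (map_of (zip bs rs) b)" for b
    have "m = finprod addgrp (\<lambda>b. ract n M (r b) b) (set bs)"
      unfolding m zip_conv_map_map_of[OF bs(1,3)] r_def by (rule lcomb_eq_finprod) (use bs B in auto)
    then show "\<exists>F r. finite F \<and> F \<subseteq> B \<and> m = finprod addgrp (\<lambda>b. ract n M (r b) b) F"
      using bs(2) by (intro exI[of _ "set bs"] exI[of _ r]) simp
  next
    fix F r b assume F: "finite F" "F \<subseteq> B" and zero: "finprod addgrp (\<lambda>b. ract n M (r b) b) F = lzero M" and b: "b \<in> F"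
    obtain bs where bs: "set bs = F" "distinct bs" using finite_distinct_list[OF F(1)] by blast
    have "zip (map r bs) bs = map (\<lambda>b. (r b, b)) bs" by (simp add: zip_map1 zip_same_conv_map)
    then have "lcomb M (ract n M) (zip (map r bs) bs) = lzero M"
      using lcomb_eq_finprod[of bs r] bs zero F(2) B by simp
    then have "\<forall>x\<in>set (map r bs). x = 0" using ind[of bs "map r bs"] bs F by simp
    then show "r b = 0" using b bs by simp
  qed
qed

text \<open>The carrier of \<open>M\<close> is a bare set with its own addition, so the lattice
  argument does not apply to it directly. Freeness replaces it by the finitely supported functions
  from \<open>B\<close> to K[x], where addition is pointwise and torsion-freeness is evident, and
  the action is transported along.\<close>

theorem CM_module_iso_dsum:
  fixes M :: "('k::field Kx mat, 'm) lmod"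
  assumes n: "3 \<le> n" and CM: "CM_module n M"
  shows "\<exists>l. (\<forall>p. p \<notin> pair_index n \<longrightarrow> l p = 0) \<and> lmod_iso n M (dsum_module n l)"
proof -
  have mod: "is_Lambda_module n M" and free: "R_free n M" and fg: "finitely_generated n M"
    using CM by (simp_all add: CM_module_def)
  interpret M: Lambda_module n M by unfold_locales (rule mod)
  obtain B where B: "B \<subseteq> lcarrier M"
    and span: "\<And>m. m \<in> lcarrier M \<Longrightarrow> \<exists>F r. finite F \<and> F \<subseteq> B \<and> m = finprod M.addgrp (\<lambda>b. ract n M (r b) b) F"
    and ind: "\<And>F r b. finite F \<Longrightarrow> F \<subseteq> B \<Longrightarrow> finprod M.addgrp (\<lambda>b. ract n M (r b) b) F = lzero M \<Longrightarrow> b \<in> F \<Longrightarrow> r b = 0"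
    using R_free_finprod[OF free mod] by blast
  define V where "V = {r :: 'm \<Rightarrow> 'k poly. finite {b. r b \<noteq> 0} \<and> {b. r b \<noteq> 0} \<subseteq> B}"
  \<comment> \<open>The coordinate map read backwards; its inverse \<open>c\<close> is available
    once independence and spanning have given bijectivity.\<close>
  define comb where "comb r = finprod M.addgrp (\<lambda>b. ract n M (r b) b) {b. r b \<noteq> 0}" for r
  define sc where "sc p r = (\<lambda>b. p * r b)" for p :: "'k poly" and r :: "'m \<Rightarrow> 'k poly"
  have BM: "b \<in> lcarrier M" if "b \<in> B" for b using that B by blast
  have comb_superset: "comb r = finprod M.addgrp (\<lambda>b. ract n M (r b) b) F"
    if "finite F" "F \<subseteq> B" "{b. r b \<noteq> 0} \<subseteq> F" for r F
    unfolding comb_def by (rule M.G.finprod_mono_neutral_cong_left) (use that BM in \<open>auto simp: M.ract_zero_left\<close>)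
  have comb_closed: "comb r \<in> lcarrier M" if "r \<in> V" for r
    unfolding comb_def by (rule M.G.finprod_closed) (use that BM in \<open>auto simp: V_def\<close>)
  have V_add: "r + s \<in> V" if "r \<in> V" "s \<in> V" for r s
  proof -
    have "{b. (r + s) b \<noteq> 0} \<subseteq> {b. r b \<noteq> 0} \<union> {b. s b \<noteq> 0}" by auto
    then show ?thesis using that unfolding V_def by (auto intro: finite_subset)
  qed
  have V_sc: "sc p r \<in> V" if "r \<in> V" for p r
  proof -
    have "{b. sc p r b \<noteq> 0} \<subseteq> {b. r b \<noteq> 0}" by (auto simp: sc_def)
    then show ?thesis using that unfolding V_def by (auto intro: finite_subset)
  qed
  have comb_add: "comb (r + s) = ladd M (comb r) (comb s)" if "r \<in> V" "s \<in> V" for r s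
  proof -
    let ?F = "{b. r b \<noteq> 0} \<union> {b. s b \<noteq> 0}"
    have F: "finite ?F" "?F \<subseteq> B" using that by (auto simp: V_def)
    have "comb (r + s) = finprod M.addgrp (\<lambda>b. ract n M ((r + s) b) b) ?F"
      by (rule comb_superset[OF F]) auto
    also have "\<dots> = finprod M.addgrp (\<lambda>b. ladd M (ract n M (r b) b) (ract n M (s b) b)) ?F"
      by (rule M.G.finprod_cong') (use F BM in \<open>auto simp: M.ract_add_left\<close>)
    also have "\<dots> = ladd M (finprod M.addgrp (\<lambda>b. ract n M (r b) b) ?F) (finprod M.addgrp (\<lambda>b. ract n M (s b) b) ?F)"
      by (rule M.G.finprod_multf) (use F BM in auto)
    finally show ?thesis using comb_superset[OF F, of r] comb_superset[OF F, of s] by auto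
  qed
  have ract_finprod: "ract n M p (finprod M.addgrp f F) = finprod M.addgrp (\<lambda>b. ract n M p (f b)) F"
    if "finite F" "f \<in> F \<rightarrow> lcarrier M" for p f F
    using that
  proof (induction F rule: finite_induct)
    case empty then show ?case by (simp add: M.ract_zero)
  next
    case (insert x F)
    then have *: "f \<in> F \<rightarrow> lcarrier M" "f x \<in> lcarrier M" by auto
    then have "(\<lambda>b. ract n M p (f b)) \<in> F \<rightarrow> lcarrier M" by (auto simp: Pi_iff)
    then show ?case
      using insert * by (simp add: M.G.finprod_insert M.ract_add M.G.finprod_closed)
  qed
  have comb_sc: "comb (sc p r) = ract n M p (comb r)" if "r \<in> V" for p r
  proof -
    let ?F = "{b. r b \<noteq> 0}"
    have F: "finite ?F" "?F \<subseteq> B" using that by (auto simp: V_def)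
    have "comb (sc p r) = finprod M.addgrp (\<lambda>b. ract n M (sc p r b) b) ?F"
      by (rule comb_superset[OF F]) (auto simp: sc_def)
    also have "\<dots> = finprod M.addgrp (\<lambda>b. ract n M p (ract n M (r b) b)) ?F"
      by (rule M.G.finprod_cong') (use F BM in \<open>auto simp: M.ract_mult sc_def\<close>)
    also have "\<dots> = ract n M p (comb r)"
      unfolding comb_def by (rule ract_finprod[symmetric]) (use F BM in auto)
    finally show ?thesis .
  qed
  have V0: "0 \<in> V" by (simp add: V_def)
  have comb0: "comb 0 = lzero M" by (simp add: comb_def)
  interpret F: torsion_free_poly_module sc
    by unfold_locales (auto simp: sc_def fun_eq_iff algebra_simps)
  have subspace_V: "F.subspace V"
    by (rule F.subspaceI) (use V0 V_add V_sc in auto)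
  have comb_inj: "inj_on comb V"
  proof (rule inj_onI)
    fix r s assume rs: "r \<in> V" "s \<in> V" "comb r = comb s"
    have d: "r - s \<in> V" using F.subspace_diff[OF subspace_V] rs by blast
    have "ladd M (comb (r - s)) (comb s) = comb s" using comb_add[OF d rs(2)] rs(3) by simp
    then have "comb (r - s) = lzero M" using comb_closed d rs(2) by (simp add: M.G.l_cancel_one)
    then have "(r - s) b = 0" for b
      using ind[of "{b. (r - s) b \<noteq> 0}" "r - s" b] d unfolding comb_def V_def by blast
    then show "r = s" by (auto simp: fun_eq_iff)
  qed
  have comb_surj: "\<exists>r\<in>V. comb r = m" if m: "m \<in> lcarrier M" for m
  proof -
    obtain F r where F: "finite F" "F \<subseteq> B" "m = finprod M.addgrp (\<lambda>b. ract n M (r b) b) F" using span[OF m] by blast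
    define r' where "r' b = (if b \<in> F then r b else 0)" for b
    have sub: "{b. r' b \<noteq> 0} \<subseteq> F" by (auto simp: r'_def)
    have "comb r' = finprod M.addgrp (\<lambda>b. ract n M (r' b) b) F" by (rule comb_superset[OF F(1,2) sub])
    also have "\<dots> = m" unfolding F(3) by (rule M.G.finprod_cong') (use F BM in \<open>auto simp: r'_def\<close>)
    finally have "comb r' = m" .
    moreover have "r' \<in> V" unfolding V_def using sub F finite_subset by auto
    ultimately show ?thesis by blast
  qed
  have comb_bij: "bij_betw comb V (lcarrier M)"
    by (rule bij_betw_imageI[OF comb_inj]) (use comb_closed comb_surj in force)
  define c where "c = the_inv_into V comb"
  have c_bij: "bij_betw c (lcarrier M) V" unfolding c_def by (rule bij_betw_the_inv_into[OF comb_bij])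
  have c_comb: "c (comb r) = r" if "r \<in> V" for r unfolding c_def by (rule the_inv_into_f_f[OF comb_inj that])
  have comb_c: "comb (c m) = m" if "m \<in> lcarrier M" for m
    unfolding c_def by (rule f_the_inv_into_f_bij_betw[OF comb_bij]) (use that in simp)
  have c_V: "c m \<in> V" if "m \<in> lcarrier M" for m using bij_betwE[OF c_bij] that by blast
  have c_eqI: "c m = r" if "r \<in> V" "comb r = m" for r m using c_comb that by blast
  have c_add: "c (ladd M a b) = c a + c b" if "a \<in> lcarrier M" "b \<in> lcarrier M" for a b
    by (rule c_eqI) (use that V_add c_V comb_add comb_c in auto)
  have c_ract: "c (ract n M p a) = sc p (c a)" if "a \<in> lcarrier M" for a p
    by (rule c_eqI) (use that V_sc c_V comb_sc comb_c in auto)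
  have c_zero: "c (lzero M) = 0" by (rule c_eqI[OF V0 comb0])
  define act where "act A r = c (lact M A (comb r))" for A r
  obtain gs where gs: "set gs \<subseteq> lcarrier M"
    and gen: "\<And>m. m \<in> lcarrier M \<Longrightarrow> \<exists>As. length As = length gs \<and> set As \<subseteq> Lambda n \<and> m = lcomb M (lact M) (zip As gs)"
    using fg unfolding finitely_generated_def by blast
  interpret Lambda_lattice sc n V act "c ` set gs"
  proof unfold_locales
    show "3 \<le> n" by (rule n)
    show "F.subspace V" by (rule subspace_V)
    show "finite (c ` set gs)" by simp
    show "c ` set gs \<subseteq> V" using c_V gs by blast
    fix A B :: "'k Kx mat" and v :: "'m \<Rightarrow> 'k poly" assume A: "A \<in> Lambda n" and v: "v \<in> V"
    show "act A v \<in> V" unfolding act_def using A v comb_closed c_V by simp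
    show "act A (u + v) = act A u + act A v" if "u \<in> V" for u
      unfolding act_def using A v that by (simp add: comb_add comb_closed M.lact_add c_add)
    assume B: "B \<in> Lambda n"
    show "act (A + B) v = act A v + act B v"
      unfolding act_def using A B v by (simp add: comb_closed M.lact_add_mat c_add)
    show "act (A * B) v = act A (act B v)"
      unfolding act_def using A B v by (simp add: comb_closed M.lact_mult comb_c)
  next
    fix v r assume "v \<in> V"
    then show "act (to_fract r \<cdot>\<^sub>m 1\<^sub>m n) v = sc r v"
      using c_ract[OF comb_closed, of v r] unfolding act_def ract_def by (simp add: c_comb)
  next
    \<comment> \<open>Finite generation is given by lists of matrices; induction on the list keeps
      the coordinates of each partial combination in \<open>S\<close>.\<close>
    fix S assume S: "F.subspace S" and SG: "\<And>A g. A \<in> Lambda n \<Longrightarrow> g \<in> c ` set gs \<Longrightarrow> act A g \<in> S"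
    have "c (lcomb M (lact M) (zip As hs)) \<in> S \<and> lcomb M (lact M) (zip As hs) \<in> lcarrier M"
      if "length As = length hs" "set As \<subseteq> Lambda n" "set hs \<subseteq> set gs" for As hs
      using that
    proof (induction As hs rule: list_induct2)
      case Nil then show ?case using F.subspace_0[OF S] by (simp only: zip.simps lcomb.simps c_zero M.lzero_closed simp_thms)
    next
      case (Cons A As h hs)
      then have h: "h \<in> lcarrier M" "A \<in> Lambda n" "h \<in> set gs" using gs by auto
      have "c (lact M A h) \<in> S" using SG[OF h(2), of "c h"] h unfolding act_def by (simp add: comb_c)
      moreover from Cons have IH: "c (lcomb M (lact M) (zip As hs)) \<in> S" "lcomb M (lact M) (zip As hs) \<in> lcarrier M" by auto
      ultimately have "c (lact M A h) + c (lcomb M (lact M) (zip As hs)) \<in> S" by (intro F.subspace_add[OF S])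
      then have "c (ladd M (lact M A h) (lcomb M (lact M) (zip As hs))) \<in> S"
        by (simp only: c_add[OF M.lact_closed[OF h(2,1)] IH(2)])
      then show ?case using IH(2) h by (simp del: plus_fun_apply)
    qed
    then have "c m \<in> S" if "m \<in> lcarrier M" for m using gen[OF that] by blast
    then show "V \<subseteq> S" using c_comb comb_closed by (metis subsetI)
  qed
  show ?thesis
  proof (rule isomorphism_to_dsum)
    fix l and \<Phi> :: "('m \<Rightarrow> 'k poly) \<Rightarrow> nat \<times> nat \<times> nat \<Rightarrow> 'k Kx vec"
    assume l: "\<And>p. p \<notin> pair_index n \<Longrightarrow> l p = 0"
      and bij: "bij_betw \<Phi> V (lcarrier (dsum_module n l :: (_, nat \<times> nat \<times> nat \<Rightarrow> 'k Kx vec) lmod))"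
      and add: "\<And>u v. u \<in> V \<Longrightarrow> v \<in> V \<Longrightarrow> \<Phi> (u + v) = (\<lambda>p. \<Phi> u p + \<Phi> v p)"
      and mult: "\<And>A v. A \<in> Lambda n \<Longrightarrow> v \<in> V \<Longrightarrow> \<Phi> (act A v) = (\<lambda>p. A *\<^sub>v \<Phi> v p)"
    have "lmod_iso n M (dsum_module n l :: (_, nat \<times> nat \<times> nat \<Rightarrow> 'k Kx vec) lmod)"
      unfolding lmod_iso_def
    proof (intro exI[of _ "\<Phi> \<circ> c"] conjI ballI)
      show "bij_betw (\<Phi> \<circ> c) (lcarrier M) (lcarrier (dsum_module n l :: (_, nat \<times> nat \<times> nat \<Rightarrow> 'k Kx vec) lmod))"
        by (rule bij_betw_trans[OF c_bij bij])
      fix a assume a: "a \<in> lcarrier M"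
      show "(\<Phi> \<circ> c) (ladd M a b) = ladd (dsum_module n l) ((\<Phi> \<circ> c) a) ((\<Phi> \<circ> c) b)" if "b \<in> lcarrier M" for b
        using a that by (simp add: c_add add c_V dsum_module_def)
      show "(\<Phi> \<circ> c) (lact M A a) = lact (dsum_module n l) A ((\<Phi> \<circ> c) a)" if A: "A \<in> Lambda n" for A
        using mult[OF A c_V[OF a]] a A unfolding act_def by (simp add: comb_c dsum_module_def)
    qed
    with l show ?thesis by blast
  qed
qed

section \<open>Uniqueness of multiplicities and indecomposability\<close>

text \<open>A homogeneous system with more unknowns than equations has a nontrivial solution; the
  induction is Gaussian elimination, one equation at a time.\<close>

lemma card_less_imp_kernel:
  fixes T :: "'b \<Rightarrow> 'a \<Rightarrow> 'k::field"
  assumes "finite B" "finite A" "card B < card A"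
  shows "\<exists>c. (\<exists>a\<in>A. c a \<noteq> 0) \<and> (\<forall>b\<in>B. (\<Sum>a\<in>A. c a * T b a) = 0)"
  using assms
proof (induction B arbitrary: A T rule: finite_induct)
  case empty
  then have "A \<noteq> {}" by auto
  then show ?case by (intro exI[of _ "\<lambda>_. 1"]) auto
next
  case (insert b B)
  show ?case
  proof (cases "\<exists>a\<in>A. T b a \<noteq> 0")
    case False
    have "card B < card A" using insert by simp
    from insert.IH[OF insert.prems(1) this, of T] False show ?thesis by auto
  next
    case True
    then obtain x where x: "x \<in> A" "T b x \<noteq> 0" by blast
    \<comment> \<open>Equation \<open>b\<close> is solved for the unknown \<open>x\<close> and
      substituted into the others.\<close>
    define T' where "T' b' a = T b' a - T b' x * (T b a / T b x)" for b' a
    have "card B < card (A - {x})" using insert x by simp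
    then obtain c where c: "\<exists>a\<in>A-{x}. c a \<noteq> 0" "\<And>b'. b' \<in> B \<Longrightarrow> (\<Sum>a\<in>A-{x}. c a * T' b' a) = 0"
      using insert.IH[of "A - {x}" T'] insert.prems(1) by auto
    define S where "S = (\<Sum>a\<in>A-{x}. c a * T b a)"
    \<comment> \<open>The value at \<open>x\<close> that makes equation \<open>b\<close>
      hold.\<close>
    define c' where "c' = c(x := - (S / T b x))"
    have sum: "(\<Sum>a\<in>A. c' a * T b' a) = - (S / T b x) * T b' x + (\<Sum>a\<in>A-{x}. c a * T b' a)" for b'
      using x(1) insert.prems(1) by (simp add: sum.remove[of A x] c'_def)
    show ?thesis
    proof (intro exI[of _ c'] conjI ballI)
      show "\<exists>a\<in>A. c' a \<noteq> 0" using c(1) by (auto simp: c'_def)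
      fix b' assume "b' \<in> insert b B"
      then consider "b' = b" | "b' \<in> B" by blast
      then show "(\<Sum>a\<in>A. c' a * T b' a) = 0"
      proof cases
        case 1
        then show ?thesis unfolding sum S_def using x(2) by simp
      next
        case 2
        have "(\<Sum>a\<in>A-{x}. c a * T' b' a) = (\<Sum>a\<in>A-{x}. c a * T b' a) - T b' x / T b x * S"
          unfolding T'_def S_def sum_distrib_left sum_subtractf[symmetric]
          by (rule sum.cong) (simp_all add: algebra_simps)
        then show ?thesis using c(2)[OF 2] unfolding sum by (simp add: field_simps)
      qed
    qed
  qed
qed

lemma lmod_iso_sym:
  assumes "is_Lambda_module n M" "lmod_iso n M N"
  shows "lmod_iso n N M"
proof -
  interpret Lambda_module n M by unfold_locales (rule assms(1))
  obtain f where f: "bij_betw f (lcarrier M) (lcarrier N)"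
    and add: "\<And>a b. a \<in> lcarrier M \<Longrightarrow> b \<in> lcarrier M \<Longrightarrow> f (ladd M a b) = ladd N (f a) (f b)"
    and act: "\<And>A a. A \<in> Lambda n \<Longrightarrow> a \<in> lcarrier M \<Longrightarrow> f (lact M A a) = lact N A (f a)"
    using assms(2) unfolding lmod_iso_def by blast
  define g where "g = the_inv_into (lcarrier M) f"
  have g: "bij_betw g (lcarrier N) (lcarrier M)" unfolding g_def by (rule bij_betw_the_inv_into[OF f])
  have gf: "g (f a) = a" if "a \<in> lcarrier M" for a
    unfolding g_def by (rule the_inv_into_f_f[OF bij_betw_imp_inj_on[OF f] that])
  have fg: "f (g b) = b" if "b \<in> lcarrier N" for b
    unfolding g_def by (rule f_the_inv_into_f_bij_betw[OF f]) (use that in simp)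
  have gM: "g b \<in> lcarrier M" if "b \<in> lcarrier N" for b using bij_betwE[OF g] that by blast
  show ?thesis unfolding lmod_iso_def
  proof (intro exI[of _ g] conjI ballI)
    show "bij_betw g (lcarrier N) (lcarrier M)" by (rule g)
    fix a assume a: "a \<in> lcarrier N"
    show "g (ladd N a b) = ladd M (g a) (g b)" if b: "b \<in> lcarrier N" for b
      using gf[of "ladd M (g a) (g b)"] add[of "g a" "g b"] gM a b fg by simp
    show "g (lact N A a) = lact M A (g a)" if A: "A \<in> Lambda n" for A
      using gf[of "lact M A (g a)"] act[OF A, of "g a"] gM A a fg by simp
  qed
qed

lemma lmod_iso_trans:
  assumes "lmod_iso n M N" "lmod_iso n N P"
  shows "lmod_iso n M P"
proof -
  obtain f where f: "bij_betw f (lcarrier M) (lcarrier N)"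
    "\<forall>a\<in>lcarrier M. \<forall>b\<in>lcarrier M. f (ladd M a b) = ladd N (f a) (f b)"
    "\<forall>A\<in>Lambda n. \<forall>a\<in>lcarrier M. f (lact M A a) = lact N A (f a)"
    using assms(1) unfolding lmod_iso_def by blast
  obtain g where g: "bij_betw g (lcarrier N) (lcarrier P)"
    "\<forall>a\<in>lcarrier N. \<forall>b\<in>lcarrier N. g (ladd N a b) = ladd P (g a) (g b)"
    "\<forall>A\<in>Lambda n. \<forall>a\<in>lcarrier N. g (lact N A a) = lact P A (g a)"
    using assms(2) unfolding lmod_iso_def by blast
  show ?thesis unfolding lmod_iso_def
    by (rule exI[of _ "g \<circ> f"]) (use bij_betw_trans[OF f(1) g(1)] f g bij_betwE[OF f(1)] in auto)
qed

section \<open>Entries of pair modules and direct sums\<close>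

lemma pair_set_carrier: "v \<in> pair_set n i j \<Longrightarrow> v \<in> carrier_vec n"
  by (simp add: pair_set_def)

lemma pair_set_entry:
  assumes "v \<in> pair_set n i j" "k < n"
  obtains p where "v $ k = to_fract p" "polX ^ pexpn i j k dvd p"
proof -
  have "in_xR (int (pexpn i j k)) (v $ k)" using assms unfolding pair_set_def pexp_eq_pexpn by simp
  then show thesis using that by (auto simp: in_xR_iff_dvd)
qed

lemma smult_unit_vec_in_pair_set:
  assumes "polX ^ pexpn i j k dvd p"
  shows "to_fract p \<cdot>\<^sub>v unit_vec n k \<in> pair_set n i j"
  unfolding pair_set_def pexp_eq_pexpn
  using assms by (auto simp: in_xR_iff_dvd unit_vec_def)

lemma zero_in_pair_set: "0\<^sub>v n \<in> pair_set n i j"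
  by (simp add: pair_set_def)

lemma dsum_carrier_iff:
  "f \<in> lcarrier (dsum_module n l) \<longleftrightarrow>
    (\<forall>i j t. if (i, j, t) \<in> dsum_index n l then f (i, j, t) \<in> pair_set n i j else f (i, j, t) = 0\<^sub>v n)"
  by (simp add: dsum_module_def dsum_index_def)

lemma dsum_carrier_carrier_vec: "f \<in> lcarrier (dsum_module n l) \<Longrightarrow> f s \<in> carrier_vec n"
  unfolding dsum_carrier_iff by (cases s) (metis pair_set_carrier zero_carrier_vec)

lemma dsum_ops [simp]:
  "ladd (dsum_module n l) f g = (\<lambda>p. f p + g p)" "lact (dsum_module n l) A f = (\<lambda>p. A *\<^sub>v f p)"
  by (simp_all add: dsum_module_def)

lemma pair_module_ops [simp]:
  "lcarrier (pair_module n i j) = pair_set n i j" "ladd (pair_module n i j) = (+)"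
  "lact (pair_module n i j) = (\<lambda>A v. A *\<^sub>v v)"
  by (simp_all add: pair_module_def)

lemma carrier_vec_self_add: "v \<in> carrier_vec n \<Longrightarrow> v + v = v \<Longrightarrow> (v :: 'a::ab_group_add vec) = 0\<^sub>v n"
proof (rule eq_vecI)
  fix k assume v: "v \<in> carrier_vec n" "v + v = v" and k: "k < dim_vec (0\<^sub>v n :: 'a vec)"
  have "(v + v) $ k = v $ k" using v by simp
  then show "v $ k = 0\<^sub>v n $ k" using v(1) k by simp
qed simp

lemma mult_mat_zero_vec: "A \<in> Lambda n \<Longrightarrow> A *\<^sub>v 0\<^sub>v n = 0\<^sub>v n"
  using Lambda_carrier[of A n] by (intro eq_vecI) auto

lemma scalar_mult_mat_vec: "v \<in> carrier_vec n \<Longrightarrow> (c \<cdot>\<^sub>m 1\<^sub>m n) *\<^sub>v v = (c :: 'a::comm_ring_1) \<cdot>\<^sub>v v"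
  by (intro eq_vecI) (auto simp: scalar_prod_def if_distrib[of "\<lambda>a. a * _"] if_distrib[of "\<lambda>a. _ * a"] cong: if_cong)

lemma emat_mult_unit_vec: "k < n \<Longrightarrow> emat n 0 k 1 *\<^sub>v (c \<cdot>\<^sub>v unit_vec n k) = (c :: 'a::comm_ring_1) \<cdot>\<^sub>v unit_vec n 0"
  by (subst emat_mult_vec) (auto simp: unit_vec_def)

text \<open>An isomorphism between two direct sums preserves the pairs of conditions \<open>a \<in> E\<^bsub>1k\<^esub> N\<close>,
  \<open>x a \<in> E\<^bsub>1q\<^esub> N\<close>. Modulo \<open>x E\<^bsub>11\<^esub> N\<close> the elements satisfying them form a vector space
  whose dimension is the number of summands \<open>(i, j)\<close> with \<open>k \<le> i\<close> and \<open>q \<le> j\<close>.\<close>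

lemma dsum_iso_card_le:
  fixes l l' :: "nat \<times> nat \<Rightarrow> nat"
  assumes n: "0 < n" and kq: "1 \<le> k" "k \<le> n" "1 \<le> q" "q \<le> n"
    and iso: "lmod_iso n (dsum_module n l :: ('k::field Kx mat, _) lmod) (dsum_module n l' :: ('k Kx mat, _) lmod)"
  shows "card {(i, j, t) \<in> dsum_index n l. k \<le> i \<and> q \<le> j} \<le> card {(i, j, t) \<in> dsum_index n l'. k \<le> i \<and> q \<le> j}"
proof (rule ccontr)
  define H where "H = {(i, j, t) \<in> dsum_index n l. k \<le> i \<and> q \<le> j}"
  define H' where "H' = {(i, j, t) \<in> dsum_index n l'. k \<le> i \<and> q \<le> j}"
  let ?N = "dsum_module n l :: ('k Kx mat, nat \<times> nat \<times> nat \<Rightarrow> 'k Kx vec) lmod"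
  let ?N' = "dsum_module n l' :: ('k Kx mat, nat \<times> nat \<times> nat \<Rightarrow> 'k Kx vec) lmod"
  assume "\<not> card {(i, j, t) \<in> dsum_index n l. k \<le> i \<and> q \<le> j} \<le> card {(i, j, t) \<in> dsum_index n l'. k \<le> i \<and> q \<le> j}"
  then have less: "card H' < card H" by (simp add: H_def H'_def)
  have fin: "finite H" "finite H'" unfolding H_def H'_def
    by (rule finite_subset[OF _ finite_dsum_index], blast)+
  obtain f where f: "bij_betw f (lcarrier ?N) (lcarrier ?N')"
    and add: "\<And>a b. a \<in> lcarrier ?N \<Longrightarrow> b \<in> lcarrier ?N \<Longrightarrow> f (\<lambda>p. a p + b p) = (\<lambda>p. f a p + f b p)"
    and act: "\<And>A a. A \<in> Lambda n \<Longrightarrow> a \<in> lcarrier ?N \<Longrightarrow> f (\<lambda>p. A *\<^sub>v a p) = (\<lambda>p. A *\<^sub>v f a p)"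
    using iso unfolding lmod_iso_def by auto
  have fN: "f a \<in> lcarrier ?N'" if "a \<in> lcarrier ?N" for a using bij_betwE[OF f] that by blast
  have f_vec: "f a s \<in> carrier_vec n" if "a \<in> lcarrier ?N" for a s
    by (rule dsum_carrier_carrier_vec[OF fN[OF that]])
  define vecs where "vecs S p m = (\<lambda>s. if s \<in> S then to_fract (p s) \<cdot>\<^sub>v unit_vec n m else (0\<^sub>v n :: 'k Kx vec))"
    for S :: "(nat \<times> nat \<times> nat) set" and p m
  have vecs_N: "vecs S p m \<in> lcarrier ?N"
    if "S \<subseteq> H" "\<And>i j t. (i, j, t) \<in> S \<Longrightarrow> polX ^ pexpn i j m dvd p (i, j, t)" for S p m
    unfolding dsum_carrier_iff vecs_def
    using that by (auto simp: H_def intro!: smult_unit_vec_in_pair_set zero_in_pair_set)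
  have i1: "1 \<le> i" if "(i, j, t) \<in> dsum_index n m" for i j t m
    using that by (simp add: dsum_index_def pair_index_def)
  have vecs0_N: "vecs S p 0 \<in> lcarrier ?N" if "S \<subseteq> H" for S p
    by (rule vecs_N[OF that]) (use that i1 in \<open>fastforce simp: H_def pexpn_def\<close>)
  \<comment> \<open>The numerator of a rational function known to be a polynomial; other values are
    irrelevant.\<close>
  define num where "num x = inv_into UNIV (to_fract :: 'k poly \<Rightarrow> _) x" for x
  have num [simp]: "num (to_fract p) = p" for p
    unfolding num_def by (rule inv_into_f_f) (auto intro: injI)
  have entry: "\<exists>p. f a s $ m = to_fract p" if "a \<in> lcarrier ?N" "m < n" for a s m
  proof -
    have "f a s $ m = to_fract 0 \<or> f a s \<in> pair_set n (fst s) (fst (snd s))"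
      using fN[OF that(1)] that(2) unfolding dsum_carrier_iff
      by (metis index_zero_vec(1) prod.collapse to_fract_0)
    then show ?thesis using pair_set_entry that(2) by metis
  qed
  \<comment> \<open>Reads \<open>f a\<close> at component \<open>s\<close> modulo x. For each
    \<open>s\<close> it is K-linear in \<open>a\<close>.\<close>
  define ev where "ev s a = coeff (num (f a s $ 0)) 0" for s a
  have ev_add: "ev s (\<lambda>p. a p + b p) = ev s a + ev s b" if ab: "a \<in> lcarrier ?N" "b \<in> lcarrier ?N" for a b s
  proof -
    obtain p r where "f a s $ 0 = to_fract p" "f b s $ 0 = to_fract r" using entry ab n by blast
    then show ?thesis unfolding ev_def add[OF ab] using f_vec[OF ab(2), of s] n
      by (simp flip: to_fract_add)
  qed
  have ev_scale: "ev s (\<lambda>p. (to_fract [:c:] \<cdot>\<^sub>m 1\<^sub>m n) *\<^sub>v a p) = c * ev s a" if a: "a \<in> lcarrier ?N" for a s c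
  proof -
    obtain p where "f a s $ 0 = to_fract p" using entry a n by blast
    then show ?thesis unfolding ev_def act[OF scalar_in_Lambda a] using f_vec[OF a, of s] n
      by (simp add: scalar_mult_mat_vec flip: to_fract_mult)
  qed
  define e where "e s = vecs {s} (\<lambda>_. 1) 0" for s
  \<comment> \<open>There are fewer functionals, one for each index in \<open>H'\<close>, than unit
    vectors, one for each index in \<open>H\<close>; hence a nonzero constant combination is killed
    by all of them.\<close>
  obtain c where c: "\<exists>s\<in>H. c s \<noteq> 0" "\<And>s'. s' \<in> H' \<Longrightarrow> (\<Sum>s\<in>H. c s * ev s' (e s)) = 0"
    using card_less_imp_kernel[OF fin(2,1) less, of "\<lambda>s' s. ev s' (e s)"] by blast
  define a where "a = vecs H (\<lambda>s. [:c s:]) 0"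
  have aN: "a \<in> lcarrier ?N" unfolding a_def by (rule vecs0_N) simp
  have zero_N: "(\<lambda>s. 0\<^sub>v n) \<in> lcarrier ?N" by (auto simp: dsum_carrier_iff zero_in_pair_set)
  have ev_vecs: "ev s' (vecs S (\<lambda>s. [:c s:]) 0) = (\<Sum>s\<in>S. c s * ev s' (e s))" if "S \<subseteq> H" for S s'
    using finite_subset[OF that fin(1)] that
  proof (induction S rule: finite_induct)
    case empty
    have "(\<lambda>p :: nat \<times> nat \<times> nat. 0\<^sub>v n + 0\<^sub>v n) = (\<lambda>p. 0\<^sub>v n :: 'k Kx vec)" by simp
    then have "ev s' (\<lambda>p. 0\<^sub>v n) = 0"
      using ev_add[OF zero_N zero_N, of s'] by (simp only: add_cancel_right_right)
    then show ?case by (simp add: vecs_def)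
  next
    case (insert s S)
    have s: "e s \<in> lcarrier ?N" unfolding e_def using insert.prems by (intro vecs0_N) simp
    have "vecs (insert s S) (\<lambda>s. [:c s:]) 0 = (\<lambda>p. vecs {s} (\<lambda>_. [:c s:]) 0 p + vecs S (\<lambda>s. [:c s:]) 0 p)"
      using insert.hyps(2) by (auto simp: fun_eq_iff vecs_def)
    moreover have "(\<lambda>p. (to_fract [:c s:] \<cdot>\<^sub>m 1\<^sub>m n) *\<^sub>v e s p) = vecs {s} (\<lambda>_. [:c s:]) 0"
      by (auto simp: fun_eq_iff vecs_def e_def scalar_mult_mat_vec)
    moreover have "vecs {s} (\<lambda>_. [:c s:]) 0 \<in> lcarrier ?N" "vecs S (\<lambda>s. [:c s:]) 0 \<in> lcarrier ?N"
      using insert.prems by (intro vecs0_N; simp)+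
    ultimately show ?case
      using insert ev_scale[OF s, of s' "c s"] ev_add[of "vecs {s} (\<lambda>_. [:c s:]) 0" "vecs S (\<lambda>s. [:c s:]) 0" s'] by simp
  qed
  \<comment> \<open>On \<open>H\<close> the bounds \<open>k \<le> i\<close> and
    \<open>q \<le> j\<close> make \<open>a\<close> and \<open>x a\<close> images of elements of the
    module under row matrices. Such relations are preserved by \<open>f\<close>, and so constrain
    \<open>f a\<close>.\<close>
  have a_row: "a = (\<lambda>s. emat n 0 (k - 1) 1 *\<^sub>v vecs H (\<lambda>s. [:c s:]) (k - 1) s)"
    unfolding a_def vecs_def using kq
    by (auto simp: fun_eq_iff emat_mult_unit_vec mult_mat_zero_vec)
  have a_row_N: "vecs H (\<lambda>s. [:c s:]) (k - 1) \<in> lcarrier ?N"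
    by (rule vecs_N) (use kq in \<open>auto simp: H_def pexpn_def\<close>)
  have xa_row: "(\<lambda>s. (to_fract polX \<cdot>\<^sub>m 1\<^sub>m n) *\<^sub>v a s) = (\<lambda>s. emat n 0 (q - 1) 1 *\<^sub>v vecs H (\<lambda>s. polX * [:c s:]) (q - 1) s)"
    unfolding a_def vecs_def using kq
    by (auto simp: fun_eq_iff emat_mult_unit_vec mult_mat_zero_vec scalar_mult_mat_vec smult_smult_assoc simp flip: to_fract_mult)
  have xa_row_N: "vecs H (\<lambda>s. polX * [:c s:]) (q - 1) \<in> lcarrier ?N"
  proof (rule vecs_N)
    fix i j t assume "(i, j, t) \<in> H"
    then have "pexpn i j (q - 1) = 0 \<or> pexpn i j (q - 1) = 1" using kq by (auto simp: H_def pexpn_def)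
    then show "polX ^ pexpn i j (q - 1) dvd polX * [:c (i, j, t):]" by (metis dvd_triv_left one_dvd power_0 power_one_right)
  qed simp
  have fa_row: "f a s $ 0 = f (vecs H (\<lambda>s. [:c s:]) (k - 1)) s $ (k - 1)" for s
  proof -
    have "f a = (\<lambda>s. emat n 0 (k - 1) 1 *\<^sub>v f (vecs H (\<lambda>s. [:c s:]) (k - 1)) s)"
      unfolding a_row by (rule act[OF emat_row_in_Lambda a_row_N]) simp
    then have "f a s $ 0 = (emat n 0 (k - 1) 1 *\<^sub>v f (vecs H (\<lambda>s. [:c s:]) (k - 1)) s) $ 0"
      by (rule arg_cong[OF fun_cong])
    then show ?thesis using n kq f_vec[OF a_row_N, of s] by (simp add: emat_mult_vec)
  qed
  have fxa_row: "xvar * f a s $ 0 = f (vecs H (\<lambda>s. polX * [:c s:]) (q - 1)) s $ (q - 1)" for s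
  proof -
    have "(\<lambda>s. (to_fract polX \<cdot>\<^sub>m 1\<^sub>m n) *\<^sub>v f a s) = f (\<lambda>s. (to_fract polX \<cdot>\<^sub>m 1\<^sub>m n) *\<^sub>v a s)"
      by (rule act[OF scalar_in_Lambda aN, symmetric])
    also have "\<dots> = (\<lambda>s. emat n 0 (q - 1) 1 *\<^sub>v f (vecs H (\<lambda>s. polX * [:c s:]) (q - 1)) s)"
      unfolding xa_row by (rule act[OF emat_row_in_Lambda xa_row_N]) simp
    finally have "((to_fract polX \<cdot>\<^sub>m 1\<^sub>m n) *\<^sub>v f a s) $ 0 = (emat n 0 (q - 1) 1 *\<^sub>v f (vecs H (\<lambda>s. polX * [:c s:]) (q - 1)) s) $ 0"
      by (rule arg_cong[OF fun_cong])
    then show ?thesis using n kq f_vec[OF aN, of s] f_vec[OF xa_row_N, of s]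
      by (simp add: emat_mult_vec scalar_mult_mat_vec xvar_def)
  qed
  have fa_dvd: "\<exists>r. f a s $ 0 = to_fract (polX * r)" for s
  proof (cases "s \<in> dsum_index n l'")
    case False
    then have "f a s = 0\<^sub>v n" using fN[OF aN] unfolding dsum_carrier_iff by (metis prod_cases3)
    then show ?thesis using n by (intro exI[of _ 0]) simp
  next
    case True
    obtain i j t where s: "s = (i, j, t)" by (cases s)
    obtain p where p: "f a s $ 0 = to_fract p" using entry[OF aN] n by blast
    have pair: "f b s \<in> pair_set n i j" if "b \<in> lcarrier ?N" for b
      using fN[OF that] True unfolding dsum_carrier_iff s by meson
    have "k - 1 < n" "q - 1 < n" using kq by linarith+
    have ij: "i < j" using True by (simp add: s dsum_index_def pair_index_def)
    have "coeff p 0 = 0"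
    proof -
      \<comment> \<open>If \<open>i < k\<close>, row \<open>k - 1\<close> of the target forces a
        factor x. If \<open>j < q\<close>, then \<open>i < j\<close> makes the exponent in row
        \<open>q - 1\<close> equal to 2, and one x remains after cancelling. In the last case the
        index lies in \<open>H'\<close> and the choice of \<open>c\<close> applies.\<close>
      consider "i < k" | "j < q" | "k \<le> i \<and> q \<le> j" by linarith
      then show ?thesis
      proof cases
        case 1
        obtain r where r: "f (vecs H (\<lambda>s. [:c s:]) (k - 1)) s $ (k - 1) = to_fract r" "polX ^ pexpn i j (k - 1) dvd r"
          using pair_set_entry[OF pair[OF a_row_N] \<open>k - 1 < n\<close>] by blast
        have "(polX :: 'k poly) dvd polX ^ pexpn i j (k - 1)" using 1 by (intro dvd_power) (auto simp: pexpn_def)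
        then have "polX dvd p" using r p fa_row[of s] by (metis dvd_trans to_fract_eq_iff)
        then show ?thesis by (auto elim: dvdE)
      next
        case 2
        obtain r where r: "f (vecs H (\<lambda>s. polX * [:c s:]) (q - 1)) s $ (q - 1) = to_fract r" "polX ^ pexpn i j (q - 1) dvd r"
          using pair_set_entry[OF pair[OF xa_row_N] \<open>q - 1 < n\<close>] by blast
        have "r = polX * p" using r(1) p fxa_row[of s] by (metis to_fract_eq_iff to_fract_mult xvar_def)
        moreover have "(polX :: 'k poly) ^ pexpn i j (q - 1) = polX * polX" using 2 ij by (auto simp: pexpn_def power2_eq_square)
        ultimately have "polX * polX dvd polX * p" using r(2) by (simp only:)
        then have "polX dvd p" unfolding dvd_mult_cancel_left by simp
        then show ?thesis by (auto elim: dvdE)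
      next
        case 3
        then have "s \<in> H'" using True s by (simp add: H'_def)
        then have "ev s a = 0" unfolding a_def ev_vecs[OF order_refl] by (rule c(2))
        then show ?thesis unfolding ev_def p by simp
      qed
    qed
    then have "polX dvd p" by (rule polX_dvd)
    then show ?thesis using p by (auto elim!: dvdE simp del: mult_pCons_left)
  qed
  then obtain r where r: "\<And>s. f a s $ 0 = to_fract (polX * r s)" by metis
  \<comment> \<open>Since \<open>a\<close> is concentrated in entry 0, so is \<open>f a\<close>.
    Divisibility of that entry thus makes the whole \<open>f a\<close> equal to x times an element
    \<open>b'\<close> of the target, where entry 0 is unrestricted because
    \<open>1 \<le> i\<close>.\<close>
  have a_E00: "a = (\<lambda>s. emat n 0 0 1 *\<^sub>v a s)"
    unfolding a_def vecs_def using n by (auto simp: fun_eq_iff emat_mult_unit_vec mult_mat_zero_vec)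
  have "f (\<lambda>s. emat n 0 0 1 *\<^sub>v a s) = (\<lambda>s. emat n 0 0 1 *\<^sub>v f a s)"
    by (rule act[OF emat_row_in_Lambda aN]) simp
  then have fa_E00: "f a s = emat n 0 0 1 *\<^sub>v f a s" for s
    unfolding a_E00[symmetric] by (rule fun_cong)
  define b' where "b' = (\<lambda>s. if s \<in> dsum_index n l' then to_fract (r s) \<cdot>\<^sub>v unit_vec n 0 else (0\<^sub>v n :: 'k Kx vec))"
  have "b' \<in> lcarrier ?N'"
    unfolding dsum_carrier_iff b'_def using i1
    by (auto intro!: smult_unit_vec_in_pair_set simp: pexpn_def Suc_le_eq)
  then obtain b where b: "b \<in> lcarrier ?N" "f b = b'" using bij_betw_imp_surj_on[OF f] by (metis imageE)
  have "f a s = (to_fract polX \<cdot>\<^sub>m 1\<^sub>m n) *\<^sub>v b' s" for s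
  proof (cases "s \<in> dsum_index n l'")
    case False
    then have "f a s = 0\<^sub>v n" using fN[OF aN] unfolding dsum_carrier_iff by (metis prod_cases3)
    then show ?thesis using False by (simp add: b'_def mult_mat_zero_vec[OF scalar_in_Lambda])
  next
    case True
    have "f a s $ m = (if m = 0 then to_fract (polX * r s) else 0)" if m: "m < n" for m
    proof -
      have "f a s $ m = (emat n 0 0 1 *\<^sub>v f a s) $ m" by (rule arg_cong[OF fa_E00])
      then show ?thesis using r[of s] f_vec[OF aN, of s] m n by (simp add: emat_mult_vec)
    qed
    then show ?thesis using True f_vec[OF aN, of s]
      by (auto intro!: eq_vecI simp: b'_def scalar_mult_mat_vec unit_vec_def simp flip: to_fract_mult)
  qed
  then have "f a = (\<lambda>s. (to_fract polX \<cdot>\<^sub>m 1\<^sub>m n) *\<^sub>v f b s)" by (simp add: fun_eq_iff b(2))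
  also have "\<dots> = f (\<lambda>s. (to_fract polX \<cdot>\<^sub>m 1\<^sub>m n) *\<^sub>v b s)" by (rule act[OF scalar_in_Lambda b(1), symmetric])
  finally have eq: "f a = f (\<lambda>s. (to_fract polX \<cdot>\<^sub>m 1\<^sub>m n) *\<^sub>v b s)" .
  have xb: "(\<lambda>s. (to_fract polX \<cdot>\<^sub>m 1\<^sub>m n) *\<^sub>v b s) = (\<lambda>s. to_fract polX \<cdot>\<^sub>v b s)"
    using dsum_carrier_carrier_vec[OF b(1)] by (simp add: scalar_mult_mat_vec)
  have "to_fract polX \<cdot>\<^sub>v v \<in> pair_set n i j" if "v \<in> pair_set n i j" for i j and v :: "'k Kx vec"
    using that unfolding pair_set_def pexp_eq_pexpn in_xR_iff_dvd
    by (auto simp: to_fract_mult[symmetric] simp del: to_fract_mult mult_pCons_left)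
  then have "(\<lambda>s. to_fract polX \<cdot>\<^sub>v b s) \<in> lcarrier ?N" using b(1) unfolding dsum_carrier_iff by auto
  \<comment> \<open>Injectivity pulls divisibility by x back to \<open>a\<close>, whose first
    entries on \<open>H\<close> are constants, not all zero.\<close>
  then have "a = (\<lambda>s. to_fract polX \<cdot>\<^sub>v b s)"
    using inj_onD[OF bij_betw_imp_inj_on[OF f] _ aN] eq unfolding xb by blast
  then have ab: "a s $ 0 = to_fract polX * b s $ 0" for s
    using dsum_carrier_carrier_vec[OF b(1), of s] n by simp
  obtain s where s: "s \<in> H" "c s \<noteq> 0" using c(1) by blast
  obtain i j t where ijt: "s = (i, j, t)" by (cases s)
  have "b s \<in> pair_set n i j" using s(1) b(1) unfolding dsum_carrier_iff ijt H_def by (metis (mono_tags, lifting) mem_Collect_eq case_prodD)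
  then obtain p where "b s $ 0 = to_fract p" using pair_set_entry n by metis
  then have "to_fract [:c s:] = to_fract polX * to_fract p" using ab[of s] s(1) n by (simp add: a_def vecs_def)
  then have "[:c s:] = polX * p" by (simp only: to_fract_mult[symmetric] to_fract_eq_iff)
  then show False using s(2) by simp
qed

lemma card_dsum_index_ge:
  "card {(i, j, t) \<in> dsum_index n l. k \<le> i \<and> q \<le> j} = (\<Sum>p\<in>{(i, j) \<in> pair_index n. k \<le> i \<and> q \<le> j}. l p)"
proof -
  let ?D = "{(i, j) \<in> pair_index n. k \<le> i \<and> q \<le> j}"
  have "finite ?D" by (rule finite_subset[OF _ finite_pair_index[of n]]) auto
  have "{(i, j, t) \<in> dsum_index n l. k \<le> i \<and> q \<le> j} = (\<lambda>((i, j), t). (i, j, t)) ` (SIGMA p:?D. {..<l p})"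
    by (force simp: dsum_index_def)
  then have "card {(i, j, t) \<in> dsum_index n l. k \<le> i \<and> q \<le> j} =
      card ((\<lambda>((i, j), t). (i, j, t)) ` (SIGMA p:?D. {..<l p}))" by (rule arg_cong)
  also have "\<dots> = card (SIGMA p:?D. {..<l p})"
    by (rule card_image) (auto simp: inj_on_def)
  also have "\<dots> = (\<Sum>p\<in>?D. l p)" using \<open>finite ?D\<close> by (simp add: card_SigmaI)
  finally show ?thesis .
qed

text \<open>Isomorphic sums have equal corner sums over \<open>k \<le> i\<close> and
  \<open>q \<le> j\<close>. At a disagreement with largest \<open>i + j\<close> all other terms of
  its corner have larger index sum and agree, so the corner sums would differ.\<close>

theorem dsum_iso_imp_eq:
  fixes l l' :: "nat \<times> nat \<Rightarrow> nat"
  assumes n: "0 < n"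
    and zero: "\<And>p. p \<notin> pair_index n \<Longrightarrow> l p = 0" "\<And>p. p \<notin> pair_index n \<Longrightarrow> l' p = 0"
    and iso: "lmod_iso n (dsum_module n l :: ('k::field Kx mat, _) lmod) (dsum_module n l' :: ('k Kx mat, _) lmod)"
      "lmod_iso n (dsum_module n l' :: ('k Kx mat, _) lmod) (dsum_module n l :: ('k Kx mat, _) lmod)"
  shows "l = l'"
proof (rule ccontr)
  assume "l \<noteq> l'"
  then obtain p where p: "l p \<noteq> l' p" by (meson ext)
  then obtain p where p: "l p \<noteq> l' p" and max: "\<And>p'. l p' \<noteq> l' p' \<Longrightarrow> fst p' + snd p' \<le> fst p + snd p"
  proof -
    have "\<forall>p. l p \<noteq> l' p \<longrightarrow> fst p + snd p < Suc (n + n)"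
    proof (intro allI impI)
      fix p assume "l p \<noteq> l' p"
      then have "p \<in> pair_index n" using zero[of p] by metis
      then show "fst p + snd p < Suc (n + n)" by (auto simp: pair_index_def)
    qed
    from ex_has_greatest_nat[OF p this] show thesis using that by blast
  qed
  obtain k q where kq: "p = (k, q)" by (cases p)
  have pin: "p \<in> pair_index n" using p zero[of p] by metis
  let ?D = "{(i, j) \<in> pair_index n. k \<le> i \<and> q \<le> j}"
  have fin: "finite ?D" by (rule finite_subset[OF _ finite_pair_index[of n]]) auto
  have pD: "p \<in> ?D" using pin kq by simp
  have "sum l ?D = sum l' ?D"
    using dsum_iso_card_le[OF n _ _ _ _ iso(1), of k q] dsum_iso_card_le[OF n _ _ _ _ iso(2), of k q] pin
    unfolding card_dsum_index_ge kq pair_index_def by auto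
  moreover have "sum l (?D - {p}) = sum l' (?D - {p})"
  proof (rule sum.cong[OF refl], rule ccontr)
    fix p' assume p': "p' \<in> ?D - {p}" "l p' \<noteq> l' p'"
    from max[OF p'(2)] p'(1) show False unfolding kq by auto
  qed
  ultimately show False using p sum.remove[OF fin pD, of l] sum.remove[OF fin pD, of l'] by linarith
qed

text \<open>A matrix \<open>E_0k\<close> moves a nonzero entry to position 0, so every nonzero
  submodule contains a nonzero polynomial multiple of the first unit vector. Cross multiplication
  makes two such multiples equal.\<close>

lemma (in Lambda_module) indecomposable_if_iso_pair:
  assumes n: "0 < n" and ij: "1 \<le> i" and iso: "lmod_iso n M (pair_module n i j)"
  shows "indecomposable n M"
proof -
  obtain f where f: "bij_betw f (lcarrier M) (pair_set n i j)"
    and add: "\<And>a b. a \<in> lcarrier M \<Longrightarrow> b \<in> lcarrier M \<Longrightarrow> f (ladd M a b) = f a + f b"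
    and act: "\<And>A a. A \<in> Lambda n \<Longrightarrow> a \<in> lcarrier M \<Longrightarrow> f (lact M A a) = A *\<^sub>v f a"
    using iso unfolding lmod_iso_def by auto
  have inj: "inj_on f (lcarrier M)" by (rule bij_betw_imp_inj_on[OF f])
  have f_pair: "f a \<in> pair_set n i j" if "a \<in> lcarrier M" for a using bij_betwE[OF f] that by blast
  have f_zero: "f (lzero M) = 0\<^sub>v n"
    by (rule carrier_vec_self_add[OF pair_set_carrier[OF f_pair[OF lzero_closed]]])
      (simp flip: add add: ladd_zero)
  have f_zero_iff: "f a = 0\<^sub>v n \<longleftrightarrow> a = lzero M" if "a \<in> lcarrier M" for a
    using inj_onD[OF inj _ that lzero_closed] f_zero by auto
  have unit: "c \<noteq> 0 \<Longrightarrow> to_fract c \<cdot>\<^sub>v unit_vec n 0 \<noteq> 0\<^sub>v n" for c :: "'k poly"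
    using n by (auto dest!: arg_cong[of _ _ "\<lambda>v. v $ 0"])
  have submodule_elt: "\<exists>p a. p \<noteq> 0 \<and> a \<in> N \<and> f a = to_fract p \<cdot>\<^sub>v unit_vec n 0"
    if N: "submodule n N M" "N \<noteq> {lzero M}" for N
  proof -
    have NM: "N \<subseteq> lcarrier M" "lzero M \<in> N" using N(1) by (auto simp: submodule_def)
    then obtain a where a: "a \<in> N" "a \<noteq> lzero M" using N(2) by blast
    then have aM: "a \<in> lcarrier M" using NM by blast
    have "f a \<noteq> 0\<^sub>v n" using f_zero_iff[OF aM] a by simp
    then obtain k where k: "k < n" "f a $ k \<noteq> 0"
      using pair_set_carrier[OF f_pair[OF aM]] by (metis carrier_vecD eq_vecI index_zero_vec)
    obtain p where p: "f a $ k = to_fract p" using pair_set_entry[OF f_pair[OF aM] k(1)] by metis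
    have "f (lact M (emat n 0 k 1) a) = to_fract p \<cdot>\<^sub>v unit_vec n 0"
      using act[OF emat_row_in_Lambda aM, of 0 k] p k(1) pair_set_carrier[OF f_pair[OF aM]]
      by (auto simp: emat_mult_vec unit_vec_def)
    moreover have "lact M (emat n 0 k 1) a \<in> N" using N(1) a by (auto simp: submodule_def)
    moreover have "p \<noteq> 0" using k p by auto
    ultimately show ?thesis by blast
  qed
  have "to_fract 1 \<cdot>\<^sub>v unit_vec n 0 \<in> pair_set n i j"
    using ij by (intro smult_unit_vec_in_pair_set) (simp add: pexpn_def)
  then have "lcarrier M \<noteq> {lzero M}"
    using bij_betw_imp_surj_on[OF f] unit[of 1] f_zero by auto
  moreover have "N1 = {lzero M} \<or> N2 = {lzero M}"
    if N: "submodule n N1 M" "submodule n N2 M" "N1 \<inter> N2 = {lzero M}" for N1 N2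
  proof (rule ccontr)
    assume "\<not> (N1 = {lzero M} \<or> N2 = {lzero M})"
    then obtain p a r b where p: "p \<noteq> 0" "a \<in> N1" "f a = to_fract p \<cdot>\<^sub>v unit_vec n 0"
      and r: "r \<noteq> 0" "b \<in> N2" "f b = to_fract r \<cdot>\<^sub>v unit_vec n 0"
      using submodule_elt[OF N(1)] submodule_elt[OF N(2)] by blast
    have M: "a \<in> lcarrier M" "b \<in> lcarrier M" using N p r by (auto simp: submodule_def)
    let ?a = "lact M (to_fract r \<cdot>\<^sub>m 1\<^sub>m n) a" and ?b = "lact M (to_fract p \<cdot>\<^sub>m 1\<^sub>m n) b"
    have fa: "f ?a = to_fract (p * r) \<cdot>\<^sub>v unit_vec n 0"
      unfolding act[OF scalar_in_Lambda M(1)] p(3) by (simp add: scalar_mult_mat_vec smult_smult_assoc mult.commute)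
    have fb: "f ?b = to_fract (p * r) \<cdot>\<^sub>v unit_vec n 0"
      unfolding act[OF scalar_in_Lambda M(2)] r(3) by (simp add: scalar_mult_mat_vec smult_smult_assoc mult.commute)
    have "?a = ?b"
      using inj_onD[OF inj, of ?a ?b] fa fb M by (simp add: scalar_in_Lambda)
    moreover have "?a \<in> N1" using N(1) p(2) by (simp add: submodule_def scalar_in_Lambda)
    moreover have "?b \<in> N2" using N(2) r(2) by (simp add: submodule_def scalar_in_Lambda)
    ultimately have "?a = lzero M" using N(3) by auto
    then have "to_fract (p * r) \<cdot>\<^sub>v unit_vec n 0 = 0\<^sub>v n" using fa f_zero by simp
    then show False using unit[of "p * r"] p r by simp
  qed
  ultimately show ?thesis unfolding indecomposable_def by blast
qed

text \<open>A nonzero direct sum has some summand \<open>s\<close>. Splitting off that nonzero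
  summand forces its complement to vanish, so projection to component \<open>s\<close> is
  injective.\<close>

lemma (in Lambda_module) iso_pair_if_indecomposable:
  assumes n: "0 < n" and iso: "lmod_iso n M (dsum_module n l)" and ind: "indecomposable n M"
  shows "\<exists>i j. 1 \<le> i \<and> i < j \<and> j \<le> n \<and> lmod_iso n M (pair_module n i j)"
proof -
  let ?N = "dsum_module n l :: ('k Kx mat, nat \<times> nat \<times> nat \<Rightarrow> 'k Kx vec) lmod"
  obtain f where f: "bij_betw f (lcarrier M) (lcarrier ?N)"
    and add: "\<And>a b. a \<in> lcarrier M \<Longrightarrow> b \<in> lcarrier M \<Longrightarrow> f (ladd M a b) = (\<lambda>s. f a s + f b s)"
    and act: "\<And>A a. A \<in> Lambda n \<Longrightarrow> a \<in> lcarrier M \<Longrightarrow> f (lact M A a) = (\<lambda>s. A *\<^sub>v f a s)"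
    using iso unfolding lmod_iso_def by auto
  have inj: "inj_on f (lcarrier M)" by (rule bij_betw_imp_inj_on[OF f])
  have fN: "f a \<in> lcarrier ?N" if "a \<in> lcarrier M" for a using bij_betwE[OF f] that by blast
  have f_vec: "f a s \<in> carrier_vec n" if "a \<in> lcarrier M" for a s
    by (rule dsum_carrier_carrier_vec[OF fN[OF that]])
  have f_surj: "\<exists>a\<in>lcarrier M. f a = w" if "w \<in> lcarrier ?N" for w
    using bij_betw_imp_surj_on[OF f] that by (metis imageE)
  have f_zero: "f (lzero M) s = 0\<^sub>v n" for s
  proof (rule carrier_vec_self_add[OF f_vec[OF lzero_closed]])
    show "f (lzero M) s + f (lzero M) s = f (lzero M) s"
      using fun_cong[OF add[OF lzero_closed lzero_closed], of s] by (simp add: ladd_zero)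
  qed
  have zero_if: "a = lzero M" if "a \<in> lcarrier M" "\<And>s. f a s = 0\<^sub>v n" for a
    by (rule inj_onD[OF inj _ that(1) lzero_closed]) (simp add: fun_eq_iff that(2) f_zero)
  have "\<exists>s. s \<in> dsum_index n l"
  proof (rule ccontr)
    assume "\<nexists>s. s \<in> dsum_index n l"
    then have "f a s = 0\<^sub>v n" if "a \<in> lcarrier M" for a s
      using fN[OF that] unfolding dsum_carrier_iff by (metis prod_cases3)
    then have "lcarrier M = {lzero M}" using zero_if by auto
    then show False using ind by (simp add: indecomposable_def)
  qed
  then obtain i j t where s0: "(i, j, t) \<in> dsum_index n l" by auto
  then have ij: "1 \<le> i" "i < j" "j \<le> n" by (auto simp: dsum_index_def pair_index_def)
  define s where "s = (i, j, t)"
  have f_pair: "f a s \<in> pair_set n i j" if "a \<in> lcarrier M" for a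
    using fN[OF that] s0 unfolding dsum_carrier_iff s_def by meson
  define inj_s where "inj_s v = (\<lambda>p. if p = s then v else (0\<^sub>v n :: 'k Kx vec))" for v
  have inj_s: "inj_s v \<in> lcarrier ?N" if "v \<in> pair_set n i j" for v
    using that s0 zero_in_pair_set by (auto simp: dsum_carrier_iff inj_s_def s_def)
  define N1 where "N1 = {a \<in> lcarrier M. \<forall>p. p \<noteq> s \<longrightarrow> f a p = 0\<^sub>v n}"
  define N2 where "N2 = {a \<in> lcarrier M. f a s = 0\<^sub>v n}"
  have sub1: "submodule n N1 M"
    unfolding submodule_def N1_def using f_zero by (auto simp: add act mult_mat_zero_vec)
  have sub2: "submodule n N2 M"
    unfolding submodule_def N2_def using f_zero by (auto simp: add act mult_mat_zero_vec)
  have int: "N1 \<inter> N2 = {lzero M}"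
  proof -
    have "a = lzero M" if "a \<in> N1 \<inter> N2" for a
    proof (rule zero_if)
      show "a \<in> lcarrier M" using that by (simp add: N1_def)
      have "\<forall>p. p \<noteq> s \<longrightarrow> f a p = 0\<^sub>v n" "f a s = 0\<^sub>v n" using that unfolding N1_def N2_def by blast+
      then show "f a p = 0\<^sub>v n" for p by (cases "p = s") blast+
    qed
    moreover have "lzero M \<in> N1 \<inter> N2" unfolding N1_def N2_def using f_zero lzero_closed by blast
    ultimately show ?thesis by blast
  qed
  have sum: "\<exists>a\<in>N1. \<exists>b\<in>N2. m = ladd M a b" if m: "m \<in> lcarrier M" for m
  proof -
    obtain a where a: "a \<in> lcarrier M" "f a = inj_s (f m s)" using f_surj[OF inj_s[OF f_pair[OF m]]] by blast
    have "(\<lambda>p. if p = s then 0\<^sub>v n else f m p) \<in> lcarrier ?N"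
      using fN[OF m] zero_in_pair_set unfolding dsum_carrier_iff by auto
    then obtain b where b: "b \<in> lcarrier M" "f b = (\<lambda>p. if p = s then 0\<^sub>v n else f m p)" using f_surj by blast
    have "f m = f (ladd M a b)"
      using f_vec[OF m] unfolding add[OF a(1) b(1)] a(2) b(2) by (auto simp: inj_s_def fun_eq_iff)
    then have "m = ladd M a b" by (rule inj_onD[OF inj _ m ladd_closed[OF a(1) b(1)]])
    moreover have "a \<in> N1" "b \<in> N2" using a b by (auto simp: N1_def N2_def inj_s_def)
    ultimately show ?thesis by blast
  qed
  have "N1 = {lzero M} \<or> N2 = {lzero M}"
    using ind sub1 sub2 int sum unfolding indecomposable_def by blast
  moreover have "N1 \<noteq> {lzero M}"
  proof
    assume N1: "N1 = {lzero M}"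
    have "to_fract 1 \<cdot>\<^sub>v unit_vec n 0 \<in> pair_set n i j"
      using ij by (intro smult_unit_vec_in_pair_set) (simp add: pexpn_def)
    then obtain a where a: "a \<in> lcarrier M" "f a = inj_s (to_fract 1 \<cdot>\<^sub>v unit_vec n 0)" using f_surj[OF inj_s] by blast
    then have "a \<in> N1" by (simp add: N1_def inj_s_def)
    then have "f a s = 0\<^sub>v n" using N1 f_zero by simp
    then have "unit_vec n 0 $ 0 = (0\<^sub>v n :: 'k Kx vec) $ 0" using a(2) by (simp add: inj_s_def)
    then show False using n by simp
  qed
  ultimately have N2: "N2 = {lzero M}" by blast
  have "lmod_iso n M (pair_module n i j)"
    unfolding lmod_iso_def pair_module_ops
  proof (intro exI[of _ "\<lambda>a. f a s"] conjI ballI)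
    show "bij_betw (\<lambda>a. f a s) (lcarrier M) (pair_set n i j)"
    proof (rule bij_betw_imageI)
      show "inj_on (\<lambda>a. f a s) (lcarrier M)"
      proof (rule inj_onI)
        fix a a' assume a: "a \<in> lcarrier M" "a' \<in> lcarrier M" "f a s = f a' s"
        \<comment> \<open>The element \<open>b\<close> is the negative of \<open>a'\<close>: the
          difference of \<open>a\<close> and \<open>a'\<close> has zero component at
          \<open>s\<close>, hence lies in \<open>N2\<close>.\<close>
        obtain b where b: "b \<in> lcarrier M" "ladd M a' b = lzero M" using ladd_inverse[OF a(2)] by blast
        have "f (ladd M a b) s = f (ladd M a' b) s"
          unfolding add[OF a(1) b(1)] add[OF a(2) b(1)] a(3) ..
        then have "ladd M a b \<in> N2" using a b f_zero by (simp add: N2_def)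
        then have "ladd M a b = ladd M a' b" using N2 b(2) by simp
        then show "a = a'" using G.right_cancel[of b a a'] a(1,2) b(1) by blast
      qed
      show "(\<lambda>a. f a s) ` lcarrier M = pair_set n i j"
      proof
        show "(\<lambda>a. f a s) ` lcarrier M \<subseteq> pair_set n i j" using f_pair by blast
        show "pair_set n i j \<subseteq> (\<lambda>a. f a s) ` lcarrier M"
        proof
          fix v :: "'k Kx vec" assume "v \<in> pair_set n i j"
          then obtain a where "a \<in> lcarrier M" "f a = inj_s v" using f_surj[OF inj_s] by blast
          then show "v \<in> (\<lambda>a. f a s) ` lcarrier M" by (intro image_eqI[of _ _ a]) (simp_all add: inj_s_def)
        qed
      qed
    qed
  qed (simp_all add: add act)
  then show ?thesis using ij by blast
qed

theorem theorem3p1: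
  fixes n :: nat and M :: "('k::field Kx mat, 'm) lmod"
  assumes "n \<ge> 3" and "CM_module n M"
  shows "(indecomposable n M \<longleftrightarrow>
            (\<exists>i j. 1 \<le> i \<and> i < j \<and> j \<le> n \<and> lmod_iso n M (pair_module n i j)))
       \<and> (\<exists>!l. (\<forall>p. p \<notin> pair_index n \<longrightarrow> l p = 0) \<and> lmod_iso n M (dsum_module n l))"
proof
  have n: "0 < n" using assms(1) by simp
  have M: "is_Lambda_module n M" using assms(2) by (simp add: CM_module_def)
  interpret Lambda_module n M by unfold_locales (rule M)
  obtain l where l: "\<forall>p. p \<notin> pair_index n \<longrightarrow> l p = 0" "lmod_iso n M (dsum_module n l)"
    using CM_module_iso_dsum[OF assms] by blast
  show "indecomposable n M \<longleftrightarrow> (\<exists>i j. 1 \<le> i \<and> i < j \<and> j \<le> n \<and> lmod_iso n M (pair_module n i j))"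
    using indecomposable_if_iso_pair[OF n] iso_pair_if_indecomposable[OF n l(2)] by blast
  show "\<exists>!l. (\<forall>p. p \<notin> pair_index n \<longrightarrow> l p = 0) \<and> lmod_iso n M (dsum_module n l)"
  proof (rule ex1I[of _ l])
    show "(\<forall>p. p \<notin> pair_index n \<longrightarrow> l p = 0) \<and> lmod_iso n M (dsum_module n l)" using l by blast
    fix l' assume l': "(\<forall>p. p \<notin> pair_index n \<longrightarrow> l' p = 0) \<and> lmod_iso n M (dsum_module n l')"
    show "l' = l"
    \<comment> \<open>Both isomorphisms pass through \<open>M\<close>. Two directions are supplied
      because each one yields only an inequality of corner sums.\<close>
    proof (rule dsum_iso_imp_eq[OF n])
      show "lmod_iso n (dsum_module n l' :: ('k Kx mat, _) lmod) (dsum_module n l :: ('k Kx mat, _) lmod)"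
        by (rule lmod_iso_trans[OF lmod_iso_sym[OF M conjunct2[OF l']] l(2)])
      show "lmod_iso n (dsum_module n l :: ('k Kx mat, _) lmod) (dsum_module n l' :: ('k Kx mat, _) lmod)"
        by (rule lmod_iso_trans[OF lmod_iso_sym[OF M l(2)] conjunct2[OF l']])
    qed (use l l' in auto)
  qed
qed

end
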